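(* Let $r\in\mathbb{N}$ and let $\mathbf{N}=(N_1,\ldots,N_r)$ be a tuple of normal subgroups of a group $G$. Assume that $N_i=\langle S_i\rangle$ for every $i=1,\ldots,r$, where: (i) $S_i$ is a normal subset of $G$; (ii) there exists $n_i\in\mathbb{N}$ such that all $n_i$th powers of elements of $N_i$ are contained in $S_i$. If for the tuple $\mathbf{S}=(S_1,\ldots,S_r)$ the set of values $\gamma_r\{\mathbf{S}\}$ is finite of order $m$, then the subgroup $\gamma_r(\mathbf{N})$ is also finite, of $(m,r,n_1,\ldots,n_r)$-bounded order.
   Context: $\mathbb{N}$ denotes the positive integers. A subset of $G$ is normal if it is invariant under conjugation by all elements of $G$. For a word $w=w(x_1,\ldots,x_r)$ and a tuple $\mathbf{S}=(S_1,\ldots,S_r)$ of subsets of $G$, $w\{\mathbf{S}\}=\{w(g_1,\ldots,g_r)\mid g_i\in S_i\}$ and $w(\mathbf{S})=\langle w\{\mathbf{S}\}\rangle$. Commutators are $[x,y]=x^{-1}y^{-1}xy$, and $\gamma_r(x_1,\ldots,x_r)=[x_1,\ldots,x_r]=[[x_1,\ldots,x_{r-1}],x_r]$, with $\gamma_1=x_1$. "$(m,r,n_1,\ldots,n_r)$-bounded" means bounded by a function depending only on $m,r,n_1,\ldots,n_r$ (and not on $G$, the $N_i$ or the $S_i$). *)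

theory Defs
  imports "HOL-Algebra.Generated_Groups"
begin

definition commutator :: "('a, 'b) monoid_scheme \<Rightarrow> 'a \<Rightarrow> 'a \<Rightarrow> 'a"
  where "commutator G x y = inv\<^bsub>G\<^esub> x \<otimes>\<^bsub>G\<^esub> inv\<^bsub>G\<^esub> y \<otimes>\<^bsub>G\<^esub> x \<otimes>\<^bsub>G\<^esub> y"

text \<open>The left-normed commutator word: an r-tuple is a list of length r, and
  \<open>gamma G [x\<^sub>1, \<dots>, x\<^sub>r] = [[x\<^sub>1, \<dots>, x\<^sub>r\<^sub>-\<^sub>1], x\<^sub>r]\<close>. The value on the empty list is never used.\<close>

fun gamma :: "('a, 'b) monoid_scheme \<Rightarrow> 'a list \<Rightarrow> 'a"
  where
    "gamma G [] = \<one>\<^bsub>G\<^esub>"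
  | "gamma G (x # xs) = foldl (commutator G) x xs"

text \<open>For a word \<open>w\<close>, regarded as a function on tuples, and a tuple \<open>Ss\<close> of subsets:
  the set of values \<open>w{Ss}\<close> and the subgroup \<open>w(Ss)\<close> it generates. Here \<open>listset [S\<^sub>1, \<dots>, S\<^sub>r]\<close> is the
  set of lists \<open>[g\<^sub>1, \<dots>, g\<^sub>r]\<close> with \<open>g\<^sub>i \<in> S\<^sub>i\<close>.\<close>

definition word_values :: "('a list \<Rightarrow> 'a) \<Rightarrow> 'a set list \<Rightarrow> 'a set"
  where "word_values w Ss = w ` listset Ss"

definition word_subgroup ::
    "('a, 'b) monoid_scheme \<Rightarrow> ('a list \<Rightarrow> 'a) \<Rightarrow> 'a set list \<Rightarrow> 'a set"
  where "word_subgroup G w Ss = generate G (word_values w Ss)"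

definition normal_subset :: "'a set \<Rightarrow> ('a, 'b) monoid_scheme \<Rightarrow> bool"
  where "normal_subset S G \<longleftrightarrow>
    S \<subseteq> carrier G \<and> (\<forall>g \<in> carrier G. \<forall>s \<in> S. inv\<^bsub>G\<^esub> g \<otimes>\<^bsub>G\<^esub> s \<otimes>\<^bsub>G\<^esub> g \<in> S)"

definition normally_generated_tuple ::
    "('a, 'b) monoid_scheme \<Rightarrow> nat \<Rightarrow> 'a set list \<Rightarrow> 'a set list \<Rightarrow> nat list \<Rightarrow> bool"
  where "normally_generated_tuple G r Ns Ss ns \<longleftrightarrow>
    length Ns = r \<and> length Ss = r \<and> length ns = r \<and>
    (\<forall>i < r.
       Ns ! i \<lhd> G \<and>
       Ns ! i = generate G (Ss ! i) \<and>
       normal_subset (Ss ! i) G \<and>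
       ns ! i \<ge> 1 \<and>
       (\<forall>x \<in> Ns ! i. x [^]\<^bsub>G\<^esub> (ns ! i) \<in> Ss ! i))"

text \<open>In \<open>G\<close>, finiteness of \<open>\<gamma>\<^sub>r{S}\<close>, with \<open>m\<close> elements, forces \<open>\<gamma>\<^sub>r(N)\<close> to be finite of order
  at most \<open>f m r [n\<^sub>1, \<dots>, n\<^sub>r]\<close>.

  A bound depending on nothing but these numbers has to be the same function for groups on all
  carrier types, whereas an \<open>\<exists>f\<close> in front of a quantifier over groups of type \<open>'a\<close> lets \<open>f\<close> depend
  on \<open>'a\<close>. The bound is therefore chosen once, on the fixed type \<^typ>\<open>nat\<close>, and is then required to be
  valid on every type. Asking this of every \<open>f\<close> that is valid on \<^typ>\<open>nat\<close> is harmless: the tuples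
  and the values involved can be found inside a finitely generated, hence countable, subgroup.\<close>

definition gamma_order_bounded ::
    "(nat \<Rightarrow> nat \<Rightarrow> nat list \<Rightarrow> nat) \<Rightarrow> ('a, 'b) monoid_scheme \<Rightarrow> bool"
  where "gamma_order_bounded f G \<longleftrightarrow>
    (\<forall>r \<ge> 1. \<forall>m Ns Ss ns.
       normally_generated_tuple G r Ns Ss ns \<longrightarrow>
       finite (word_values (gamma G) Ss) \<longrightarrow>
       card (word_values (gamma G) Ss) = m \<longrightarrow>
       finite (word_subgroup G (gamma G) Ns) \<and>
       card (word_subgroup G (gamma G) Ns) \<le> f m r ns)"

end

theory Submission
  imports Defs "HOL-Algebra.FiniteProduct" "HOL-Library.Countable_Set"
begin

text \<open>Let \<open>X = \<gamma>\<^sub>r{S}\<close>, with \<open>m\<close> elements, and \<open>K = \<langle>X\<rangle> = \<gamma>\<^sub>r(N)\<close>. Since \<open>X\<close> is finite and normal, \<open>K\<close> has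
  centre of \<open>m\<close>-bounded index, and by Dietzmann's lemma it suffices to bound the orders of the
  elements of \<open>X\<close>; by the transfer into the centre it is enough to bound them modulo \<open>K'\<close>.

  Whenever one entry of \<open>\<gamma>\<^sub>r(s\<^sub>1, \<dots>, s\<^sub>r)\<close> can be varied so that \<open>\<gamma>\<^sub>r(s\<^sub>1, \<dots>, d\<^sup>k, \<dots>, s\<^sub>r)\<close> is the \<open>k\<close>-th power of
  \<open>\<gamma>\<^sub>r(s\<^sub>1, \<dots>, d, \<dots>, s\<^sub>r)\<close> modulo a normal subgroup, the powers \<open>d\<^sup>n\<^sup>k\<close> lie in \<open>S\<^sub>i\<close>, so these values are among the \<open>m\<close>
  elements of \<open>X\<close> and have bounded order. With \<open>d \<in> K\<close> as first entry this shows that \<open>[K, N\<^sub>2, \<dots>, N\<^sub>r]\<close>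
  has bounded exponent modulo \<open>K'\<close>. With \<open>d\<close> in a normal subgroup \<open>E\<close> that centralizes \<open>K/P\<close>, a
  downward induction on the position of \<open>d\<close>, based on the three subgroups lemma, applies; for
  \<open>E = N\<^sub>l\<close> it shows that \<open>K\<close> has bounded exponent modulo \<open>[K, N\<^sub>l]\<close>. Doing this for \<open>l = 2, \<dots>, r\<close> in turn
  bounds the exponent of \<open>K/K'\<close>.

  For the comparison of carrier types, a finite part of \<open>\<gamma>\<^sub>r(N)\<close> and all of \<open>X\<close> are already visible in a finitely
  generated subgroup, which is isomorphic to a group on a set of natural numbers.\<close>

section \<open>Commutators modulo a normal subgroup\<close>

lemma (in group) inv_mult_cancel:
  assumes "a \<in> carrier G" "b \<in> carrier G"
  shows "inv a \<otimes> (a \<otimes> b) = b" and "a \<otimes> (inv a \<otimes> b) = b"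
  using assms by (simp_all flip: m_assoc)

lemmas (in group) word_simps = m_assoc inv_mult_group inv_mult_cancel

lemma (in group) commutator_closed [simp, intro]:
  assumes "x \<in> carrier G" "y \<in> carrier G"
  shows "commutator G x y \<in> carrier G"
  using assms by (simp add: commutator_def)

lemma (in group) commutator_eq_one_iff:
  assumes "x \<in> carrier G" "y \<in> carrier G"
  shows "commutator G x y = \<one> \<longleftrightarrow> x \<otimes> y = y \<otimes> x"
proof
  assume c: "commutator G x y = \<one>"
  have "x \<otimes> y = y \<otimes> x \<otimes> commutator G x y"
    using assms by (simp add: commutator_def word_simps)
  then show "x \<otimes> y = y \<otimes> x" using assms c by simp
next
  assume c: "x \<otimes> y = y \<otimes> x"
  have "commutator G x y = inv (y \<otimes> x) \<otimes> (x \<otimes> y)"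
    using assms by (simp add: commutator_def word_simps)
  then show "commutator G x y = \<one>" using assms by (simp add: c)
qed

lemma (in group) commutator_mult_left:
  assumes "a \<in> carrier G" "b \<in> carrier G" "z \<in> carrier G"
  shows "commutator G (a \<otimes> b) z = inv b \<otimes> commutator G a z \<otimes> b \<otimes> commutator G b z"
  using assms by (simp add: commutator_def word_simps)

lemma (in group) commutator_conj:
  assumes "g \<in> carrier G" "x \<in> carrier G" "y \<in> carrier G"
  shows "inv g \<otimes> commutator G x y \<otimes> g
    = commutator G (inv g \<otimes> x \<otimes> g) (inv g \<otimes> y \<otimes> g)"
  using assms by (simp add: commutator_def word_simps)

lemma (in group) commute_inv:
  assumes "a \<in> carrier G" "y \<in> carrier G" and c: "a \<otimes> y = y \<otimes> a"
  shows "inv a \<otimes> y = y \<otimes> inv a"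
proof -
  have "inv a \<otimes> y = inv a \<otimes> (y \<otimes> a) \<otimes> inv a" using assms(1,2) by (simp add: word_simps)
  also have "\<dots> = y \<otimes> inv a" using assms(1,2) by (simp flip: c) (simp add: word_simps)
  finally show ?thesis .
qed

lemma (in group) commute_mult:
  assumes "a \<in> carrier G" "b \<in> carrier G" "y \<in> carrier G"
    and "a \<otimes> y = y \<otimes> a" "b \<otimes> y = y \<otimes> b"
  shows "a \<otimes> b \<otimes> y = y \<otimes> (a \<otimes> b)"
  using assms by (metis m_assoc)

lemma (in group_hom) hom_commutator:
  assumes "x \<in> carrier G" "y \<in> carrier G"
  shows "h (commutator G x y) = commutator H (h x) (h y)"
  using assms by (simp add: commutator_def)

lemma (in normal) group_hom_Mod: "group_hom G (G Mod H) ((#>) H)"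
  unfolding group_hom_def group_hom_axioms_def
  using factorgroup_is_group is_group r_coset_hom_Mod by blast

lemma (in normal) rcos_eq_one_iff:
  assumes "x \<in> carrier G"
  shows "H #> x = \<one>\<^bsub>G Mod H\<^esub> \<longleftrightarrow> x \<in> H"
  using assms by (metis coset_join1 coset_join2 one_FactGroup subgroup_axioms subset)

lemma (in normal) commutator_mem_iff:
  assumes "x \<in> carrier G" "y \<in> carrier G"
  shows "commutator G x y \<in> H \<longleftrightarrow>
    (H #> x) \<otimes>\<^bsub>G Mod H\<^esub> (H #> y) = (H #> y) \<otimes>\<^bsub>G Mod H\<^esub> (H #> x)"
proof -
  interpret p: group_hom G "G Mod H" "(#>) H" by (rule group_hom_Mod)
  show ?thesis
    using assms p.hom_commutator[OF assms] rcos_eq_one_iff[of "commutator G x y"]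
      p.H.commutator_eq_one_iff[OF p.hom_closed p.hom_closed, OF assms] by simp
qed

lemma (in normal) commutator_mem_sym:
  assumes "x \<in> carrier G" "y \<in> carrier G"
  shows "commutator G x y \<in> H \<longleftrightarrow> commutator G y x \<in> H"
  using assms commutator_mem_iff by metis

text \<open>Modulo \<open>H\<close>, commuting with \<open>y\<close> means lying in the centralizer
  of the coset \<open>H #> y\<close>; the set is the preimage of that centralizer.\<close>

lemma (in normal) subgroup_commuting_left:
  assumes y: "y \<in> carrier G"
  shows "subgroup {x \<in> carrier G. commutator G x y \<in> H} G"
proof -
  interpret p: group_hom G "G Mod H" "(#>) H" by (rule group_hom_Mod)
  let ?y = "H #> y"
  have eq: "{x \<in> carrier G. commutator G x y \<in> H}
    = {x \<in> carrier G. (H #> x) \<otimes>\<^bsub>G Mod H\<^esub> ?y = ?y \<otimes>\<^bsub>G Mod H\<^esub> (H #> x)}" (is "_ = ?C")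
    using y commutator_mem_iff by blast
  have c: "?y \<in> carrier (G Mod H)" using y by simp
  have "subgroup ?C G"
  proof (rule subgroupI)
    have "\<one> \<in> ?C" using c p.hom_one p.H.l_one p.H.r_one by auto
    then show "?C \<noteq> {}" by blast
  next
    fix a assume "a \<in> ?C"
    then show "inv a \<in> ?C"
      using p.H.commute_inv[of "H #> a" ?y] c by (simp del: mult_FactGroup)
  next
    fix a b assume ab: "a \<in> ?C" "b \<in> ?C"
    then show "a \<otimes> b \<in> ?C"
      using p.H.commute_mult[of "H #> a" "H #> b" ?y] c by (simp del: mult_FactGroup)
  qed blast
  then show ?thesis using eq by simp
qed

text \<open>The preimages of centralizers are subgroups, so generators suffice in the left argument;
  the symmetry \<open>commutator_mem_sym\<close> then does the same for the right one.\<close>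

lemma (in normal) commutator_generate:
  assumes "A \<subseteq> carrier G" "B \<subseteq> carrier G"
    and ab: "\<And>a b. a \<in> A \<Longrightarrow> b \<in> B \<Longrightarrow> commutator G a b \<in> H"
    and "x \<in> generate G A" "y \<in> generate G B"
  shows "commutator G x y \<in> H"
proof -
  have 1: "commutator G x b \<in> H" if "b \<in> B" for b
    using generate_subgroup_incl[OF _ subgroup_commuting_left[of b], of A] that assms by blast
  have xc: "x \<in> carrier G" using assms generate_in_carrier by blast
  have "commutator G b x \<in> H" if "b \<in> B" for b
    using 1[OF that] commutator_mem_sym[of x b] xc that assms(2) by blast
  then have "y \<in> {y \<in> carrier G. commutator G y x \<in> H}"
    using generate_subgroup_incl[OF _ subgroup_commuting_left[OF xc], of B] assms by blast
  then show ?thesis using xc commutator_mem_sym[of x y] by blast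
qed

text \<open>Conjugation by \<open>z\<close> sends \<open>g\<close> to \<open>g c\<close> and
  \<open>e\<close> to \<open>e d\<close>. The commutation hypotheses allow \<open>c\<close> and
  \<open>d\<close> to be cancelled in \<open>[g c, e d]\<close>, so conjugation by \<open>z\<close>
  fixes \<open>w\<close>. This plays the role of the three subgroups lemma for single
  elements.\<close>

lemma (in group) three_subgroups_elementwise:
  assumes [simp]: "g \<in> carrier G" "e \<in> carrier G" "z \<in> carrier G"
    and "c = commutator G g z" "d = commutator G e z" "w = commutator G g e"
    and ce: "c \<otimes> e = e \<otimes> c" and cd: "c \<otimes> d = d \<otimes> c" and cw: "c \<otimes> w = w \<otimes> c"
    and dg: "d \<otimes> g = g \<otimes> d" and dw: "d \<otimes> w = w \<otimes> d"
  shows "commutator G w z = \<one>"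
proof -
  have [simp]: "c \<in> carrier G" "d \<in> carrier G" "w \<in> carrier G" using assms by auto
  have g: "inv z \<otimes> g \<otimes> z = g \<otimes> c" and e: "inv z \<otimes> e \<otimes> z = e \<otimes> d"
    using assms by (simp_all add: commutator_def word_simps)
  have ege: "inv e \<otimes> (g \<otimes> e) = g \<otimes> w"
    using assms by (simp add: commutator_def word_simps)
  have "inv z \<otimes> w \<otimes> z = commutator G (g \<otimes> c) (e \<otimes> d)"
    using commutator_conj[of z g e] assms g e by simp
  also have "\<dots> = inv c \<otimes> inv g \<otimes> inv d \<otimes> inv e \<otimes> g \<otimes> (c \<otimes> e) \<otimes> d"
    by (simp add: commutator_def word_simps)
  also have "\<dots> = inv c \<otimes> inv g \<otimes> inv d \<otimes> inv e \<otimes> g \<otimes> e \<otimes> (c \<otimes> d)"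
    by (simp only: ce) (simp add: word_simps)
  also have "\<dots> = inv c \<otimes> inv g \<otimes> inv d \<otimes> (inv e \<otimes> (g \<otimes> e)) \<otimes> d \<otimes> c"
    by (simp only: cd) (simp add: word_simps)
  also have "\<dots> = inv c \<otimes> inv g \<otimes> inv d \<otimes> (g \<otimes> (w \<otimes> d)) \<otimes> c"
    by (simp only: ege) (simp add: word_simps)
  also have "\<dots> = inv c \<otimes> inv g \<otimes> inv d \<otimes> ((d \<otimes> g) \<otimes> w) \<otimes> c"
    by (simp only: dw[symmetric] dg) (simp add: word_simps)
  also have "\<dots> = inv c \<otimes> (w \<otimes> c)" by (simp add: word_simps)
  also have "\<dots> = w" by (simp only: cw[symmetric]) (simp add: word_simps)
  finally have "z \<otimes> (inv z \<otimes> w \<otimes> z) = z \<otimes> w" by simp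
  then have "w \<otimes> z = z \<otimes> w" by (simp add: word_simps)
  then show ?thesis by (simp add: commutator_eq_one_iff)
qed

lemma (in normal) three_subgroups_mod:
  assumes "g \<in> carrier G" "e \<in> carrier G" "z \<in> carrier G"
    and "c = commutator G g z" "d = commutator G e z" "w = commutator G g e"
    and "commutator G c e \<in> H" "commutator G c d \<in> H" "commutator G c w \<in> H"
    and "commutator G d g \<in> H" "commutator G d w \<in> H"
  shows "commutator G w z \<in> H"
proof -
  interpret p: group_hom G "G Mod H" "(#>) H" by (rule group_hom_Mod)
  have [simp]: "c \<in> carrier G" "d \<in> carrier G" "w \<in> carrier G" using assms by auto
  have comm: "(H #> x) \<otimes>\<^bsub>G Mod H\<^esub> (H #> y) = (H #> y) \<otimes>\<^bsub>G Mod H\<^esub> (H #> x)"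
    if "x \<in> carrier G" "y \<in> carrier G" "commutator G x y \<in> H" for x y
    using that commutator_mem_iff by blast
  have hc: "H #> c = commutator (G Mod H) (H #> g) (H #> z)"
    "H #> d = commutator (G Mod H) (H #> e) (H #> z)"
    "H #> w = commutator (G Mod H) (H #> g) (H #> e)"
    using assms(1-6) p.hom_commutator by blast+
  have "commutator (G Mod H) (H #> w) (H #> z) = \<one>\<^bsub>G Mod H\<^esub>"
    by (rule p.H.three_subgroups_elementwise[OF _ _ _ hc])
      (rule p.hom_closed comm assms(1-3,7-) \<open>c \<in> carrier G\<close> \<open>d \<in> carrier G\<close> \<open>w \<in> carrier G\<close>)+
  then show ?thesis using rcos_eq_one_iff[of "commutator G w z"] p.hom_commutator assms(3)
    \<open>w \<in> carrier G\<close> by simp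
qed

text \<open>In \<open>[q, d^k d] = [q, d] * (d^-1 [q, d^k] d)\<close> the conjugation by
  \<open>d\<close> fixes the powers of \<open>[q, d]\<close>.\<close>

lemma (in group) commuting_commutator_pow:
  assumes "q \<in> carrier G" "d \<in> carrier G"
    and c: "commutator G q d \<otimes> d = d \<otimes> commutator G q d"
  shows "commutator G q (d [^] (k::nat)) = commutator G q d [^] k"
proof (induction k)
  case 0
  then show ?case using assms by (simp add: commutator_def)
next
  case (Suc k)
  let ?w = "commutator G q d"
  have "commutator G q (d [^] Suc k) = commutator G q d \<otimes> (inv d \<otimes> commutator G q (d [^] k) \<otimes> d)"
    using assms by (simp add: commutator_def word_simps)
  also have "\<dots> = ?w \<otimes> (inv d \<otimes> (?w [^] k \<otimes> d))"
    using assms by (simp add: Suc word_simps)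
  also have "?w [^] k \<otimes> d = d \<otimes> ?w [^] k"
    using assms by (metis c commutator_closed group_commutes_pow)
  finally show ?case using assms
    by (simp add: word_simps) (metis commutator_closed nat_pow_Suc nat_pow_Suc2)
qed

text \<open>Pigeonhole: the exponents \<open>0, ..., m\<close> give \<open>m + 1\<close> powers of
  \<open>v^n\<close> in a set of at most \<open>m\<close> elements, so two of them agree. The
  difference of their exponents is positive and at most \<open>m\<close>, hence divides
  \<open>fact m\<close>.\<close>

lemma (in group) pow_finite_range:
  assumes v: "v \<in> carrier G" and "finite Y" "card Y \<le> m"
    and Y: "\<And>k::nat. v [^] (n * k) \<in> Y"
  shows "v [^] (n * fact m) = \<one>"
proof -
  have "\<not> inj_on (\<lambda>k. v [^] (n * k)) {..m}"
    using card_inj_on_le[of "\<lambda>k. v [^] (n * k)" "{..m}" Y] assms by auto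
  then obtain a b where ab: "a \<le> m" "b \<le> m" "a < b" "v [^] (n * a) = v [^] (n * b)"
    unfolding inj_on_def by (metis atMost_iff linorder_neqE_nat)
  have "n * b = n * a + n * (b - a)" using ab by (simp flip: add_mult_distrib2)
  then have "v [^] (n * b) = v [^] (n * a) \<otimes> v [^] (n * (b - a))"
    using v by (simp add: nat_pow_mult)
  then have 1: "v [^] (n * (b - a)) = \<one>" using ab v by (metis l_cancel_one nat_pow_closed)
  have "(b - a) dvd fact m" using ab by (simp add: dvd_fact)
  then obtain t where "fact m = (b - a) * t" by auto
  then show ?thesis using 1 v by (metis mult.assoc nat_pow_one nat_pow_pow)
qed

section \<open>Iterated centralizers\<close>

lemma mem_listset_iff: "xs \<in> listset Ss \<longleftrightarrow> list_all2 (\<in>) xs Ss"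
  by (induction Ss arbitrary: xs) (auto simp: set_Cons_def list_all2_Cons2)

lemma gamma_append: "xs \<noteq> [] \<Longrightarrow> gamma G (xs @ ys) = foldl (commutator G) (gamma G xs) ys"
  by (cases xs) auto

section \<open>Conjugation of values, and normal subgroups defined by commutation\<close>

context group
begin

lemma foldl_commutator_closed:
  assumes "g \<in> carrier G" "set zs \<subseteq> carrier G"
  shows "foldl (commutator G) g zs \<in> carrier G"
  using assms by (induction zs arbitrary: g) auto

lemma gamma_closed: "set xs \<subseteq> carrier G \<Longrightarrow> gamma G xs \<in> carrier G"
  by (cases xs) (auto intro: foldl_commutator_closed)

lemma foldl_commutator_conj:
  assumes "g \<in> carrier G" "y \<in> carrier G" "set zs \<subseteq> carrier G"
  shows "inv g \<otimes> foldl (commutator G) y zs \<otimes> g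
    = foldl (commutator G) (inv g \<otimes> y \<otimes> g) (map (\<lambda>z. inv g \<otimes> z \<otimes> g) zs)"
  using assms by (induction zs arbitrary: y) (auto simp: commutator_conj)

lemma gamma_conj:
  assumes "g \<in> carrier G" "set xs \<subseteq> carrier G"
  shows "inv g \<otimes> gamma G xs \<otimes> g = gamma G (map (\<lambda>z. inv g \<otimes> z \<otimes> g) xs)"
  using assms by (cases xs) (auto simp: foldl_commutator_conj)

lemma mem_listset_carrier:
  assumes "xs \<in> listset Ss" "\<And>S. S \<in> set Ss \<Longrightarrow> S \<subseteq> carrier G"
  shows "set xs \<subseteq> carrier G"
  using assms unfolding mem_listset_iff
  by (fastforce simp: list_all2_conv_all_nth in_set_conv_nth)

lemma normal_subset_carrier: "normal_subset S G \<Longrightarrow> S \<subseteq> carrier G"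
  by (simp add: normal_subset_def)

lemma normal_subset_conj:
  assumes "normal_subset S G" "g \<in> carrier G" "s \<in> S"
  shows "inv g \<otimes> s \<otimes> g \<in> S"
  using assms by (simp add: normal_subset_def)

lemma normal_subset_word_values:
  assumes "\<And>S. S \<in> set Ss \<Longrightarrow> normal_subset S G"
  shows "normal_subset (word_values (gamma G) Ss) G"
proof -
  have sc: "set xs \<subseteq> carrier G" if "xs \<in> listset Ss" for xs
    using that assms by (meson mem_listset_carrier normal_subset_carrier)
  have "map (\<lambda>z. inv g \<otimes> z \<otimes> g) xs \<in> listset Ss"
    if "xs \<in> listset Ss" "g \<in> carrier G" for g xs
    using that assms unfolding mem_listset_iff
    by (auto simp: list_all2_conv_all_nth intro!: normal_subset_conj)
  then show ?thesis
    unfolding normal_subset_def word_values_def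
    using sc by (auto simp: gamma_conj gamma_closed)
qed

lemma normal_generate:
  assumes "normal_subset S G"
  shows "generate G S \<lhd> G"
proof (rule normal_generateI)
  fix h g assume "h \<in> S" "g \<in> carrier G"
  then show "g \<otimes> h \<otimes> inv g \<in> S"
    using normal_subset_conj[OF assms, of "inv g" h] by simp
qed (use assms normal_subset_carrier in blast)

lemma normal_conj_mem:
  assumes "N \<lhd> G" "g \<in> carrier G" "x \<in> N"
  shows "inv g \<otimes> x \<otimes> g \<in> N"
  using assms normal.inv_op_closed1 by fastforce

lemma normal_imp_normal_subset: "N \<lhd> G \<Longrightarrow> normal_subset N G"
  using normal_conj_mem normal_imp_subgroup subgroup.subset unfolding normal_subset_def by blast

lemma commutator_mem_normal_left:
  assumes "N \<lhd> G" "x \<in> N" "y \<in> carrier G"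
  shows "commutator G x y \<in> N"
proof -
  interpret N: normal N G by fact
  have "inv x \<otimes> (inv y \<otimes> x \<otimes> y) \<in> N"
    using assms normal_conj_mem by simp
  then show ?thesis using assms by (simp add: commutator_def m_assoc N.mem_carrier)
qed

lemma commutator_mem_normal_right:
  assumes "N \<lhd> G" "x \<in> carrier G" "y \<in> N"
  shows "commutator G x y \<in> N"
proof -
  interpret N: normal N G by fact
  have "commutator G y x \<in> N" using assms commutator_mem_normal_left by blast
  then show ?thesis using N.commutator_mem_sym[of x y] assms(2,3) N.mem_carrier by blast
qed

lemma normal_commuting:
  assumes "Q \<lhd> G" "normal_subset S G"
  shows "{g \<in> carrier G. \<forall>z\<in>S. commutator G g z \<in> Q} \<lhd> G" (is "?Z \<lhd> G")
proof -
  interpret Q: normal Q G by fact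
  have S: "S \<subseteq> carrier G" using assms normal_subset_carrier by blast
  have sub: "subgroup ?Z G"
  \<comment> \<open>For empty \<open>S\<close> the set is \<open>carrier G\<close>, whereas the
    empty intersection would be the whole type.\<close>
  proof (cases "S = {}")
    case True
    then show ?thesis by (simp add: subgroup_self)
  next
    case False
    then have "?Z = (\<Inter>z\<in>S. {x \<in> carrier G. commutator G x z \<in> Q})" by auto
    also have "subgroup \<dots> G"
      using False S by (intro subgroups_Inter) (auto intro: Q.subgroup_commuting_left)
    finally show ?thesis .
  qed
  have "x \<otimes> h \<otimes> inv x \<in> ?Z" if x: "x \<in> carrier G" and h: "h \<in> ?Z" for x h
  proof -
    have hc: "h \<in> carrier G" using h by simp
    have "commutator G (x \<otimes> h \<otimes> inv x) z \<in> Q" if z: "z \<in> S" for z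
    proof -
      have zc: "z \<in> carrier G" using z S by blast
      let ?z = "inv x \<otimes> z \<otimes> x"
      have "?z \<in> S" using normal_subset_conj[OF assms(2) x z] .
      then have "commutator G h ?z \<in> Q" using h by blast
      then have "inv (inv x) \<otimes> commutator G h ?z \<otimes> inv x \<in> Q"
        by (rule normal_conj_mem[OF assms(1) inv_closed[OF x]])
      moreover have "inv (inv x) \<otimes> commutator G h ?z \<otimes> inv x = commutator G (x \<otimes> h \<otimes> inv x) z"
        using x hc zc by (simp add: commutator_def word_simps)
      ultimately show ?thesis by metis
    qed
    then show ?thesis using x hc by auto
  qed
  with sub show ?thesis by (simp add: normal_inv_iff)
qed

end

text \<open>These are the \<open>g\<close> for which all left-normed commutators
  \<open>[g, z1, ..., zk]\<close> with entries from the listed sets fall into \<open>P\<close>. The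
  recursive form makes normality a one-step induction and peels off one entry when
  \<open>drop j Ss\<close> is replaced by \<open>drop (Suc j) Ss\<close>.\<close>

fun iterated_centralizer :: "('a, 'b) monoid_scheme \<Rightarrow> 'a set \<Rightarrow> 'a set list \<Rightarrow> 'a set"
  where
    "iterated_centralizer G P [] = P"
  | "iterated_centralizer G P (S # Ss) =
      {g \<in> carrier G. \<forall>z\<in>S. commutator G g z \<in> iterated_centralizer G P Ss}"

context group
begin

lemma normal_iterated_centralizer:
  assumes "P \<lhd> G" "\<And>S. S \<in> set Ss \<Longrightarrow> normal_subset S G"
  shows "iterated_centralizer G P Ss \<lhd> G"
  using assms by (induction Ss) (auto intro!: normal_commuting)

lemma iterated_centralizer_mono:
  "P \<subseteq> Q \<Longrightarrow> iterated_centralizer G P Ss \<subseteq> iterated_centralizer G Q Ss"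
  by (induction Ss) auto

lemma subset_iterated_centralizer:
  assumes "P \<lhd> G" "\<And>S. S \<in> set Ss \<Longrightarrow> normal_subset S G"
  shows "P \<subseteq> iterated_centralizer G P Ss"
  using assms
proof (induction Ss)
  case (Cons S Ss)
  have "P \<subseteq> carrier G" using Cons normal_imp_subgroup subgroup.subset by blast
  moreover have "commutator G g z \<in> iterated_centralizer G P Ss" if "g \<in> P" "z \<in> S" for g z
  proof -
    have "z \<in> carrier G" using Cons.prems(2)[of S] that normal_subset_carrier by auto
    then show ?thesis
      using commutator_mem_normal_left[OF Cons.prems(1) that(1)] Cons by auto
  qed
  ultimately show ?case by auto
qed simp

lemma mem_iterated_centralizer_iff:
  assumes "P \<subseteq> carrier G" "g \<in> carrier G" "\<And>S. S \<in> set Ss \<Longrightarrow> S \<subseteq> carrier G"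
  shows "g \<in> iterated_centralizer G P Ss \<longleftrightarrow> (\<forall>zs \<in> listset Ss. foldl (commutator G) g zs \<in> P)"
  using assms(2,3)
proof (induction Ss arbitrary: g)
  case (Cons S Ss)
  have IH: "commutator G g z \<in> iterated_centralizer G P Ss \<longleftrightarrow>
      (\<forall>zs \<in> listset Ss. foldl (commutator G) (commutator G g z) zs \<in> P)" if "z \<in> S" for z
  proof (rule Cons.IH)
    show "commutator G g z \<in> carrier G" using Cons.prems(1) Cons.prems(2)[of S] that by auto
  qed (use Cons.prems in auto)
  have "(\<forall>zs \<in> listset (S # Ss). foldl (commutator G) g zs \<in> P) \<longleftrightarrow>
      (\<forall>z\<in>S. \<forall>zs \<in> listset Ss. foldl (commutator G) (commutator G g z) zs \<in> P)"
    by (fastforce simp: set_Cons_def)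
  then show ?case using Cons.prems(1) IH by simp
qed simp

text \<open>Left-normed commutation with fixed \<open>z\<^sub>1, z\<^sub>2, \<dots>\<close> is multiplicative modulo \<open>P\<close> along a chain
  \<open>H\<^sub>0, H\<^sub>1, \<dots>\<close> in which \<open>[H\<^sub>i\<^sub>+\<^sub>1, H\<^sub>i]\<close> is killed by the remaining commutations.\<close>

lemma foldl_commutator_pow_mod:
  assumes P: "P \<lhd> G" and Ss: "\<And>S. S \<in> set Ss \<Longrightarrow> normal_subset S G"
    and H: "\<And>i. i \<le> length Ss \<Longrightarrow> subgroup (H i) G"
    and step: "\<And>i x z. i < length Ss \<Longrightarrow> x \<in> H i \<Longrightarrow> z \<in> Ss ! i \<Longrightarrow> commutator G x z \<in> H (Suc i)"
    and comm: "\<And>i x y. i < length Ss \<Longrightarrow> x \<in> H (Suc i) \<Longrightarrow> y \<in> H i \<Longrightarrow>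
      commutator G x y \<in> iterated_centralizer G P (drop (Suc i) Ss)"
    and xy: "x \<in> H 0" "y \<in> H 0" "x \<otimes> inv (y [^] (k::nat)) \<in> iterated_centralizer G P Ss"
    and zs: "zs \<in> listset Ss"
  shows "foldl (commutator G) x zs \<otimes> inv (foldl (commutator G) y zs [^] k) \<in> P"
  using Ss H step comm xy zs
proof (induction Ss arbitrary: H x y zs)
  case (Cons S Ss)
  let ?Q = "iterated_centralizer G P Ss"
  obtain z zs' where z: "zs = z # zs'" "z \<in> S" "zs' \<in> listset Ss"
    using Cons.prems(8) by (auto simp: set_Cons_def)
  have zc: "z \<in> carrier G" using z Cons.prems(1)[of S] normal_subset_carrier by auto
  have "?Q \<lhd> G" using P Cons.prems(1) by (intro normal_iterated_centralizer) auto
  then interpret Q: normal ?Q G .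
  interpret p: group_hom G "G Mod ?Q" "(#>) ?Q" by (rule Q.group_hom_Mod)
  interpret H0: subgroup "H 0" G using Cons.prems(2) by simp
  have sH: "commutator G a z \<in> H (Suc 0)" if "a \<in> H 0" for a
    using Cons.prems(3)[of 0 a z] that z by simp
  have cl: "commutator G a z \<in> carrier G" if "a \<in> H 0" for a
    using that zc H0.mem_carrier by blast
  let ?c = "\<lambda>a. ?Q #> commutator G a z"
  have cc: "?c a \<in> carrier (G Mod ?Q)" if "a \<in> H 0" for a
    using cl[OF that] p.hom_closed by blast
  \<comment> \<open>In \<open>[a b, z] = (b^-1 [a, z] b) [b, z]\<close> the conjugation by
    \<open>b\<close> has no effect modulo \<open>?Q\<close>, because \<open>[a, z]\<close> lies in
    \<open>H (Suc 0)\<close> and so commutes with \<open>b\<close> there.\<close>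
  have add: "?c (a \<otimes> b) = ?c a \<otimes>\<^bsub>G Mod ?Q\<^esub> ?c b" if "a \<in> H 0" "b \<in> H 0" for a b
  proof -
    have c: "a \<in> carrier G" "b \<in> carrier G" using that H0.mem_carrier by auto
    have "commutator G (commutator G a z) b \<in> ?Q"
      using Cons.prems(4)[of 0 "commutator G a z" b] sH that by simp
    then have cm: "?c a \<otimes>\<^bsub>G Mod ?Q\<^esub> (?Q #> b) = (?Q #> b) \<otimes>\<^bsub>G Mod ?Q\<^esub> ?c a"
      using Q.commutator_mem_iff c cl that by blast
    have bc: "?Q #> b \<in> carrier (G Mod ?Q)" using c p.hom_closed by blast
    have "?c (a \<otimes> b) = inv\<^bsub>G Mod ?Q\<^esub> (?Q #> b) \<otimes>\<^bsub>G Mod ?Q\<^esub> (?c a \<otimes>\<^bsub>G Mod ?Q\<^esub> (?Q #> b)) \<otimes>\<^bsub>G Mod ?Q\<^esub> ?c b"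
      using c zc cl that by (simp add: commutator_mult_left p.H.m_assoc del: mult_FactGroup)
    also have "\<dots> = ?c a \<otimes>\<^bsub>G Mod ?Q\<^esub> ?c b"
      unfolding cm using bc cc that p.H.inv_mult_cancel(1)[OF bc] by simp
    finally show ?thesis .
  qed
  have one: "commutator G \<one> z = \<one>" using zc by (simp add: commutator_def)
  have pow: "y [^] k \<in> H 0 \<and> ?c (y [^] k) = ?c y [^]\<^bsub>G Mod ?Q\<^esub> k" for k :: nat
  proof (induction k)
    case 0
    then show ?case using one p.hom_one H0.one_closed by simp
  next
    case (Suc k)
    then show ?case using add Cons.prems(6) by auto
  qed
  \<comment> \<open>\<open>u\<close> is the error between \<open>x\<close> and \<open>y^k\<close>.
    Commutation with \<open>z\<close> sends it into \<open>?Q\<close>, so \<open>[x, z]\<close> and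
    \<open>[y, z]^k\<close> agree modulo \<open>?Q\<close>, as the induction hypothesis
    requires.\<close>
  define u where "u = x \<otimes> inv (y [^] k)"
  have uH: "u \<in> H 0" unfolding u_def using Cons.prems(5) pow by auto
  have xu: "x = u \<otimes> y [^] k"
    unfolding u_def using Cons.prems(5,6) H0.mem_carrier by (simp add: m_assoc)
  have "commutator G u z \<in> ?Q" using Cons.prems(7) z(2) u_def by simp
  then have "?c u = \<one>\<^bsub>G Mod ?Q\<^esub>" using Q.rcos_eq_one_iff cl uH by blast
  then have "?c x = ?c y [^]\<^bsub>G Mod ?Q\<^esub> k"
    using add[OF uH, of "y [^] k"] pow xu p.H.nat_pow_closed[OF cc[OF Cons.prems(6)], of k]
    by (simp del: mult_FactGroup one_FactGroup)
  also have "\<dots> = ?Q #> (commutator G y z [^] k)"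
    using p.hom_nat_pow cl Cons.prems(6) by metis
  finally have eq: "?c x = ?Q #> (commutator G y z [^] k)" .
  have "commutator G x z \<otimes> inv (commutator G y z [^] k) \<in> ?Q"
  proof -
    have "?Q #> (commutator G x z \<otimes> inv (commutator G y z [^] k)) = \<one>\<^bsub>G Mod ?Q\<^esub>"
      using eq cl Cons.prems(5,6) by (simp del: mult_FactGroup one_FactGroup)
    moreover have "commutator G x z \<otimes> inv (commutator G y z [^] k) \<in> carrier G"
      using cl Cons.prems(5,6) by blast
    ultimately show ?thesis using Q.rcos_eq_one_iff by blast
  qed
  then have "foldl (commutator G) (commutator G x z) zs'
      \<otimes> inv (foldl (commutator G) (commutator G y z) zs' [^] k) \<in> P"
  \<comment> \<open>The chain without its first member serves for \<open>[x, z]\<close> and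
    \<open>[y, z]\<close>.\<close>
  proof (rule Cons.IH[where H = "\<lambda>i. H (Suc i)", rotated 6])
    show "subgroup (H (Suc i)) G" if "i \<le> length Ss" for i using Cons.prems(2) that by simp
    show "commutator G a b \<in> H (Suc (Suc i))"
      if "i < length Ss" "a \<in> H (Suc i)" "b \<in> Ss ! i" for i a b
      using Cons.prems(3)[of "Suc i" a b] that by simp
    show "commutator G a b \<in> iterated_centralizer G P (drop (Suc i) Ss)"
      if "i < length Ss" "a \<in> H (Suc (Suc i))" "b \<in> H (Suc i)" for i a b
      using Cons.prems(4)[of "Suc i" a b] that by simp
  qed (use Cons.prems(1,5,6) sH z in auto)
  then show ?case by (simp add: z)
qed simp

end

section \<open>Values of bounded exponent modulo a subgroup\<close>

context group
begin

lemma foldl_commutator_mem_normal: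
  assumes "N \<lhd> G" "g \<in> carrier G" "set zs \<subseteq> carrier G" "g \<in> N \<or> (\<exists>z\<in>set zs. z \<in> N)"
  shows "foldl (commutator G) g zs \<in> N"
  using assms(2-)
proof (induction zs arbitrary: g)
  case (Cons z zs)
  then show ?case
    using commutator_mem_normal_left[OF assms(1), of g z]
      commutator_mem_normal_right[OF assms(1), of g z] by auto
qed simp

lemma gamma_mem_normal:
  assumes "N \<lhd> G" "set xs \<subseteq> carrier G" "x \<in> set xs" "x \<in> N"
  shows "gamma G xs \<in> N"
  using assms by (cases xs) (auto intro!: foldl_commutator_mem_normal)

lemma conj_nat_pow:
  assumes "x \<in> carrier G" "h \<in> carrier G"
  shows "(x \<otimes> h \<otimes> inv x) [^] (n::nat) = x \<otimes> h [^] n \<otimes> inv x"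
  using assms by (induction n) (simp_all add: word_simps)

lemma subgroup_nat_pow_closed:
  assumes "subgroup H G" "x \<in> H"
  shows "x [^] (n::nat) \<in> H"
  using assms by (induction n) (simp_all add: subgroup.one_closed subgroup.m_closed)

lemma pow_mem_of_dvd:
  assumes "subgroup P G" "x \<in> carrier G" "x [^] (n::nat) \<in> P" "n dvd n'"
  shows "x [^] n' \<in> P"
proof -
  obtain t where "n' = n * t" using assms by auto
  then have "x [^] n' = (x [^] n) [^] t" using assms(2) by (simp add: nat_pow_pow)
  then show ?thesis using assms subgroup_nat_pow_closed by simp
qed

end

text \<open>Enlarging \<open>P\<close> to this set is how an exponent is paid for: a claim that
  elements have \<open>n\<close>th power in \<open>P\<close> becomes a membership claim, and the
  enlarged set can again be the target of iterated centralizers.\<close>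

definition roots :: "('a, 'b) monoid_scheme \<Rightarrow> 'a set \<Rightarrow> nat \<Rightarrow> 'a set \<Rightarrow> 'a set"
  where "roots G K n P = {k \<in> K. k [^]\<^bsub>G\<^esub> n \<in> P}"

text \<open>Since \<open>K\<close> is abelian modulo \<open>P\<close>, taking \<open>n\<close>th
  powers is multiplicative on the cosets of elements of \<open>K\<close>, and the roots are the
  elements of \<open>K\<close> with trivial image. Conjugation commutes with powers.\<close>

lemma (in group) normal_roots:
  assumes "K \<lhd> G" "P \<lhd> G" and comm: "\<And>x y. x \<in> K \<Longrightarrow> y \<in> K \<Longrightarrow> commutator G x y \<in> P"
  shows "roots G K n P \<lhd> G"
proof -
  interpret K: normal K G by fact
  interpret P: normal P G by fact
  interpret p: group_hom G "G Mod P" "(#>) P" by (rule P.group_hom_Mod)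
  have mem: "k \<in> roots G K n P \<longleftrightarrow> k \<in> K \<and> (P #> k) [^]\<^bsub>G Mod P\<^esub> n = \<one>\<^bsub>G Mod P\<^esub>" for k
  proof -
    have "k [^] n \<in> P \<longleftrightarrow> (P #> k) [^]\<^bsub>G Mod P\<^esub> n = \<one>\<^bsub>G Mod P\<^esub>" if "k \<in> K"
      using P.rcos_eq_one_iff[of "k [^] n"] p.hom_nat_pow[of k n] K.mem_carrier[OF that] by simp
    then show ?thesis by (auto simp: roots_def)
  qed
  have sub: "subgroup (roots G K n P) G"
  proof (rule subgroupI)
    show "roots G K n P \<subseteq> carrier G" by (auto simp: roots_def K.mem_carrier)
    show "roots G K n P \<noteq> {}"
      using K.one_closed P.one_closed by (auto simp: roots_def intro!: exI[of _ \<one>])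
    show "inv a \<in> roots G K n P" if "a \<in> roots G K n P" for a
      using that by (auto simp: roots_def nat_pow_inv K.mem_carrier)
    show "a \<otimes> b \<in> roots G K n P" if "a \<in> roots G K n P" "b \<in> roots G K n P" for a b
    proof -
      have ab: "a \<in> K" "b \<in> K" "a \<in> carrier G" "b \<in> carrier G"
        using that by (auto simp: roots_def K.mem_carrier)
      have "(P #> (a \<otimes> b)) [^]\<^bsub>G Mod P\<^esub> n
          = (P #> a) [^]\<^bsub>G Mod P\<^esub> n \<otimes>\<^bsub>G Mod P\<^esub> (P #> b) [^]\<^bsub>G Mod P\<^esub> n"
        unfolding p.hom_mult[OF ab(3,4)]
        using P.commutator_mem_iff comm ab
        by (intro p.H.pow_mult_distrib p.hom_closed) blast+
      then show ?thesis using that ab unfolding mem by (simp del: mult_FactGroup one_FactGroup)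
    qed
  qed
  have "x \<otimes> h \<otimes> inv x \<in> roots G K n P" if "x \<in> carrier G" "h \<in> roots G K n P" for x h
    using that by (auto simp: roots_def conj_nat_pow K.mem_carrier K.inv_op_closed2 P.inv_op_closed2)
  then show ?thesis using sub normal_inv_iff by blast
qed

lemma (in group) roots_roots:
  assumes "subgroup K G"
  shows "roots G K a (roots G K b P) = roots G K (a * b) P"
proof -
  have "k [^] (a::nat) \<in> K" if "k \<in> K" for k
    using assms that by (simp add: subgroup_nat_pow_closed)
  then show ?thesis
    using subgroup.mem_carrier[OF assms] by (auto simp: roots_def nat_pow_pow)
qed

text \<open>Lists are indexed from \<open>0\<close>: below, \<open>N i\<close> is the paper's \<open>N\<^sub>i\<^sub>+\<^sub>1\<close>, while \<open>L j = \<gamma>\<^sub>j(N\<^sub>1, \<dots>, N\<^sub>j)\<close>.\<close>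

locale finite_gamma_values = group G for G (structure) +
  fixes Ss :: "'a set list" and ns :: "nat list" and m :: nat
  assumes Ss_nonempty: "Ss \<noteq> []"
    and length_ns: "length ns = length Ss"
    and normal_S: "S \<in> set Ss \<Longrightarrow> normal_subset S G"
    and pow_S: "i < length Ss \<Longrightarrow> x \<in> generate G (Ss ! i) \<Longrightarrow> x [^] (ns ! i) \<in> Ss ! i"
    and finite_values: "finite (word_values (gamma G) Ss)"
    and card_values: "card (word_values (gamma G) Ss) \<le> m"
begin

definition r where "r = length Ss"
definition N where "N i = generate G (Ss ! i)"
definition L where "L j = generate G (word_values (gamma G) (take j Ss))"
definition K where "K = L r"
text \<open>One exponent for all positions: a multiple of every \<open>ns ! j * fact m\<close>,
  which is what the pigeonhole argument yields at position \<open>j\<close>.\<close>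

definition e0 where "e0 = prod_list ns * fact m"

lemma S_carrier: "S \<in> set Ss \<Longrightarrow> S \<subseteq> carrier G"
  using normal_S normal_subset_carrier by blast

lemma nth_S_carrier: "i < r \<Longrightarrow> Ss ! i \<subseteq> carrier G"
  using S_carrier by (simp add: r_def)

lemma normal_L: "L j \<lhd> G"
  unfolding L_def
  by (intro normal_generate normal_subset_word_values) (auto dest: in_set_takeD intro: normal_S)

lemma normal_N: "i < r \<Longrightarrow> N i \<lhd> G"
  unfolding N_def r_def by (intro normal_generate normal_S) simp

lemma S_subset_N: "i < r \<Longrightarrow> s \<in> Ss ! i \<Longrightarrow> s \<in> N i"
  unfolding N_def by (rule generate.incl)

lemma r_pos: "r \<ge> 1"
  using Ss_nonempty by (simp add: r_def Suc_le_eq)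

lemma normal_K: "K \<lhd> G"
  unfolding K_def by (rule normal_L)

lemma L_carrier: "x \<in> L j \<Longrightarrow> x \<in> carrier G"
  by (rule subgroup.mem_carrier[OF normal_imp_subgroup[OF normal_L]])

lemma N_carrier: "i < r \<Longrightarrow> x \<in> N i \<Longrightarrow> x \<in> carrier G"
  by (rule subgroup.mem_carrier[OF normal_imp_subgroup[OF normal_N]])

lemma K_carrier: "x \<in> K \<Longrightarrow> x \<in> carrier G"
  using L_carrier K_def by blast

lemma K_eq: "K = generate G (word_values (gamma G) Ss)"
  by (simp add: K_def L_def r_def)

lemma gamma_mem_K: "xs \<in> listset Ss \<Longrightarrow> gamma G xs \<in> K"
  unfolding K_eq word_values_def by (intro generate.incl) blast

lemma listset_carrier: "xs \<in> listset Ss \<Longrightarrow> set xs \<subseteq> carrier G"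
  using S_carrier mem_listset_carrier by blast

lemma listset_take_snoc:
  assumes "j < r" "xs \<in> listset (take j Ss)" "z \<in> Ss ! j"
  shows "xs @ [z] \<in> listset (take (Suc j) Ss)"
  using assms unfolding mem_listset_iff
  by (simp add: r_def take_Suc_conv_app_nth list_all2_appendI)

lemma listset_split:
  assumes "j < r" "xs \<in> listset (take j Ss)" "z \<in> Ss ! j" "zs \<in> listset (drop (Suc j) Ss)"
  shows "xs @ z # zs \<in> listset Ss"
proof -
  have "list_all2 (\<in>) (xs @ [z]) (take (Suc j) Ss)" "list_all2 (\<in>) zs (drop (Suc j) Ss)"
    using listset_take_snoc[OF assms(1-3)] assms(4) by (simp_all add: mem_listset_iff)
  from list_all2_appendI[OF this] show ?thesis by (simp add: mem_listset_iff)
qed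

lemma listset_take_length:
  assumes "j \<le> r" "xs \<in> listset (take j Ss)"
  shows "length xs = j"
  using assms list_all2_lengthD[of "(\<in>)" xs] by (simp add: mem_listset_iff r_def)

text \<open>\<open>L (Suc j)\<close> is normal, so generators suffice on both sides, and there the
  commutator is a value with one more entry.\<close>

lemma commutator_L:
  assumes "1 \<le> j" "j < r" "g \<in> L j" "z \<in> N j"
  shows "commutator G g z \<in> L (Suc j)"
proof (rule normal.commutator_generate[OF normal_L])
  show "g \<in> generate G (word_values (gamma G) (take j Ss))" "z \<in> generate G (Ss ! j)"
    using assms by (simp_all add: L_def N_def)
  show "Ss ! j \<subseteq> carrier G" using assms nth_S_carrier by blast
  show "word_values (gamma G) (take j Ss) \<subseteq> carrier G"
    by (intro normal_subset_carrier normal_subset_word_values) (auto dest: in_set_takeD intro: normal_S)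
  fix a b assume "a \<in> word_values (gamma G) (take j Ss)" "b \<in> Ss ! j"
  then obtain xs where xs: "xs \<in> listset (take j Ss)" "a = gamma G xs"
    by (auto simp: word_values_def)
  have "xs \<noteq> []" using listset_take_length[OF _ xs(1)] assms by auto
  then have "commutator G a b = gamma G (xs @ [b])" by (simp add: xs gamma_append)
  then show "commutator G a b \<in> L (Suc j)"
    using listset_take_snoc[OF assms(2) xs(1) \<open>b \<in> Ss ! j\<close>]
    unfolding L_def word_values_def by (auto intro!: generate.incl)
qed

text \<open>A single entry in the normal subgroup \<open>N i\<close> pulls the whole left-normed
  commutator into it.\<close>

lemma K_subset_N:
  assumes "i < r"
  shows "K \<subseteq> N i"
  unfolding K_eq
proof (rule generate_subgroup_incl)
  show "word_values (gamma G) Ss \<subseteq> N i"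
  proof
    fix v assume "v \<in> word_values (gamma G) Ss"
    then obtain xs where xs: "xs \<in> listset Ss" "v = gamma G xs" by (auto simp: word_values_def)
    then have "xs ! i \<in> Ss ! i" "i < length xs"
      using assms by (auto simp: mem_listset_iff list_all2_conv_all_nth r_def)
    then show "v \<in> N i"
      using gamma_mem_normal[OF normal_N[OF assms] listset_carrier[OF xs(1)], of "xs ! i"]
        S_subset_N assms xs by simp
  qed
qed (simp add: assms normal_N normal_imp_subgroup)

lemma iterated_centralizer_normal:
  "P \<lhd> G \<Longrightarrow> iterated_centralizer G P (drop j Ss) \<lhd> G"
  by (intro normal_iterated_centralizer) (auto dest: in_set_dropD intro: normal_S)

text \<open>\<open>kills E P j\<close> means \<open>[\<gamma>\<^sub>j(N\<^sub>1, \<dots>, N\<^sub>j), E, N\<^sub>j\<^sub>+\<^sub>1, \<dots>, N\<^sub>r] \<subseteq> P\<close>.\<close>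

definition kills :: "'a set \<Rightarrow> 'a set \<Rightarrow> nat \<Rightarrow> bool"
  where "kills E P j \<longleftrightarrow>
    (\<forall>g \<in> L j. \<forall>e \<in> E. commutator G g e \<in> iterated_centralizer G P (drop j Ss))"

lemma kills_mono: "kills E P j \<Longrightarrow> P \<subseteq> Q \<Longrightarrow> kills E Q j"
  unfolding kills_def using iterated_centralizer_mono by blast

text \<open>The three subgroups argument is applied to \<open>g\<close> in \<open>L j\<close>,
  \<open>e\<close> in \<open>E\<close> and an entry \<open>z\<close>. Commutators of
  \<open>[g, z]\<close> with \<open>E\<close> are covered by \<open>A\<close> one position later;
  \<open>[e, z]\<close> lies in \<open>E \<inter> N j\<close>, so its commutators with
  \<open>L j\<close> are covered by \<open>B\<close>. Hence \<open>[[g, e], z]\<close> is killed by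
  the remaining entries.\<close>

lemma kills_step:
  assumes P: "P \<lhd> G" and E: "E \<lhd> G" and j: "1 \<le> j" "j < r"
    and A: "kills E P (Suc j)"
    and B: "\<And>q d. q \<in> L j \<Longrightarrow> d \<in> E \<inter> N j \<Longrightarrow>
      commutator G q d \<in> iterated_centralizer G P (drop (Suc j) Ss)"
  shows "kills E P j"
  unfolding kills_def
proof (intro ballI)
  fix g e assume g: "g \<in> L j" and e: "e \<in> E"
  let ?Q = "iterated_centralizer G P (drop (Suc j) Ss)"
  interpret Q: normal ?Q G by (rule iterated_centralizer_normal[OF P])
  have ec: "e \<in> carrier G" using subgroup.mem_carrier[OF normal_imp_subgroup[OF E]] e by blast
  have gc: "g \<in> carrier G" using g L_carrier by blast
  have "commutator G (commutator G g e) z \<in> ?Q" if z: "z \<in> Ss ! j" for z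
  proof -
    have zc: "z \<in> carrier G" using z nth_S_carrier j by blast
    have zN: "z \<in> N j" using z S_subset_N j by blast
    have c: "commutator G g z \<in> L (Suc j)" using commutator_L j g zN by blast
    have d: "commutator G e z \<in> E \<inter> N j"
      using commutator_mem_normal_left[OF E e zc] commutator_mem_normal_right[OF normal_N ec zN] j
      by blast
    have w: "commutator G g e \<in> E" "commutator G g e \<in> L j"
      using commutator_mem_normal_right[OF E gc e] commutator_mem_normal_left[OF normal_L g ec]
      by blast+
    show ?thesis
    proof (rule Q.three_subgroups_mod[OF gc ec zc refl refl refl])
      show "commutator G (commutator G g z) e \<in> ?Q"
        "commutator G (commutator G g z) (commutator G e z) \<in> ?Q"
        "commutator G (commutator G g z) (commutator G g e) \<in> ?Q"
        using A c e d w unfolding kills_def by blast+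
      show "commutator G (commutator G e z) g \<in> ?Q"
        "commutator G (commutator G e z) (commutator G g e) \<in> ?Q"
        using B[OF g d] B[OF w(2) d] Q.commutator_mem_sym gc ec zc commutator_closed by blast+
    qed
  qed
  moreover have "drop j Ss = Ss ! j # drop (Suc j) Ss"
    using j by (simp add: Cons_nth_drop_Suc r_def)
  ultimately show "commutator G g e \<in> iterated_centralizer G P (drop j Ss)"
    using gc ec by simp
qed

text \<open>Modulo \<open>P\<close> the powers of \<open>u\<close> with exponents divisible by
  \<open>ns ! j\<close> are images of the at most \<open>m\<close> values, so
  \<open>pow_finite_range\<close> applies in the quotient.\<close>

lemma pow_values_mod:
  assumes P: "P \<lhd> G" and j: "j < r" and u: "u \<in> carrier G"
    and vals: "\<And>k. \<exists>v \<in> word_values (gamma G) Ss. v \<otimes> inv (u [^] (ns ! j * k)) \<in> P"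
  shows "u [^] e0 \<in> P"
proof -
  interpret P: normal P G by fact
  interpret p: group_hom G "G Mod P" "(#>) P" by (rule P.group_hom_Mod)
  let ?X = "word_values (gamma G) Ss"
  have Xc: "?X \<subseteq> carrier G"
    by (intro normal_subset_carrier normal_subset_word_values normal_S)
  have "(P #> u) [^]\<^bsub>G Mod P\<^esub> (ns ! j * fact m) = \<one>\<^bsub>G Mod P\<^esub>"
  proof (rule p.H.pow_finite_range)
    show "P #> u \<in> carrier (G Mod P)" using u p.hom_closed by blast
    show "finite ((#>) P ` ?X)" using finite_values by blast
    show "card ((#>) P ` ?X) \<le> m" using card_image_le[OF finite_values] card_values le_trans by blast
    fix k :: nat
    obtain v where v: "v \<in> ?X" "v \<otimes> inv (u [^] (ns ! j * k)) \<in> P" using vals by blast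
    let ?w = "u [^] (ns ! j * k)"
    have c: "v \<in> carrier G" "?w \<in> carrier G" using v Xc u by auto
    have "P #> v = P #> (v \<otimes> inv ?w \<otimes> ?w)" using c by (simp add: m_assoc)
    also have "\<dots> = (P #> (v \<otimes> inv ?w)) \<otimes>\<^bsub>G Mod P\<^esub> (P #> ?w)"
      using c by (simp del: mult_FactGroup)
    also have "P #> (v \<otimes> inv ?w) = \<one>\<^bsub>G Mod P\<^esub>"
      using v(2) c by (intro P.rcos_eq_one_iff[THEN iffD2]) auto
    also have "\<one>\<^bsub>G Mod P\<^esub> \<otimes>\<^bsub>G Mod P\<^esub> (P #> ?w) = P #> ?w"
      by (rule p.H.l_one[OF p.hom_closed[OF c(2)]])
    also have "\<dots> = (P #> u) [^]\<^bsub>G Mod P\<^esub> (ns ! j * k)" by (rule p.hom_nat_pow[OF u])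
    finally show "(P #> u) [^]\<^bsub>G Mod P\<^esub> (ns ! j * k) \<in> (#>) P ` ?X" using v(1) by blast
  qed
  then have "u [^] (ns ! j * fact m) \<in> P"
    using P.rcos_eq_one_iff p.hom_nat_pow u by (metis nat_pow_closed)
  moreover have "ns ! j dvd prod_list ns"
    using j length_ns by (intro prod_list_dvd) (auto simp: r_def)
  ultimately show ?thesis
    using pow_mem_of_dvd[OF P.subgroup_axioms u] by (simp add: e0_def mult_dvd_mono)
qed

text \<open>This is the power trick. Put \<open>d^k\<close> at position \<open>j\<close> of a value.
  As \<open>E\<close> is killed at all later positions, the result is modulo \<open>P\<close> the
  \<open>k\<close>th power of the commutator with \<open>d\<close> in that place. If
  \<open>ns ! j\<close> divides \<open>k\<close>, then \<open>d^k\<close> lies in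
  \<open>Ss ! j\<close>, so these powers are among the given values modulo \<open>P\<close>, and the
  commutator has its \<open>e0\<close>th power in \<open>P\<close>.\<close>

lemma commutator_killed:
  assumes P: "P \<lhd> G" and E: "E \<lhd> G" and j: "1 \<le> j" "j < r"
    and KP: "\<And>x y. x \<in> K \<Longrightarrow> y \<in> K \<Longrightarrow> commutator G x y \<in> P"
    and A: "\<And>i. j < i \<Longrightarrow> i \<le> r \<Longrightarrow> kills E P i"
    and q: "q \<in> L j" and d: "d \<in> E \<inter> N j"
  shows "commutator G q d \<in> iterated_centralizer G (roots G K e0 P) (drop (Suc j) Ss)"
\<comment> \<open>Only \<open>q\<close> is reduced to generators; \<open>d\<close> is kept as a
  single element because its powers are needed.\<close>
proof (rule normal.commutator_generate[of _ _ "word_values (gamma G) (take j Ss)" "{d}"])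
  let ?R = "roots G K e0 P"
  have R: "?R \<lhd> G" by (intro normal_roots normal_K P KP)
  show "iterated_centralizer G ?R (drop (Suc j) Ss) \<lhd> G"
    by (rule iterated_centralizer_normal[OF R])
  show "q \<in> generate G (word_values (gamma G) (take j Ss))" using q by (simp add: L_def)
  show "d \<in> generate G {d}" by (rule generate.incl) simp
  show "word_values (gamma G) (take j Ss) \<subseteq> carrier G"
    by (intro normal_subset_carrier normal_subset_word_values) (auto dest: in_set_takeD intro: normal_S)
  have dc: "d \<in> carrier G" using d N_carrier j by blast
  then show "{d} \<subseteq> carrier G" by simp
  fix a b assume a: "a \<in> word_values (gamma G) (take j Ss)" and "b \<in> {d}"
  then have b: "b = d" by simp
  obtain xs where xs: "xs \<in> listset (take j Ss)" "a = gamma G xs"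
    using a by (auto simp: word_values_def)
  have xs_ne: "xs \<noteq> []" using listset_take_length[OF _ xs(1)] j by auto
  have aL: "a \<in> L j" using a unfolding L_def by (rule generate.incl)
  have ac: "a \<in> carrier G" using aL L_carrier by blast
  let ?w = "commutator G a d"
  let ?Ts = "drop (Suc j) Ss"
  have wL: "commutator G a x \<in> L (Suc j) \<inter> E" if "x \<in> E \<inter> N j" for x
    using commutator_L[OF j aL, of x] commutator_mem_normal_right[OF E ac, of x] that by blast
  have NE: "subgroup (E \<inter> N j) G"
    by (intro subgroups_Inter_pair normal_imp_subgroup E normal_N j)
  have dpow: "d [^] (k::nat) \<in> E \<inter> N j" for k
    by (rule subgroup_nat_pow_closed[OF NE d])
  interpret Q: normal "iterated_centralizer G P ?Ts" G by (rule iterated_centralizer_normal[OF P])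
  interpret Qh: group_hom G "G Mod iterated_centralizer G P ?Ts" "(#>) (iterated_centralizer G P ?Ts)"
    by (rule Q.group_hom_Mod)
  \<comment> \<open>\<open>?w\<close> lies in \<open>L (Suc j)\<close> and \<open>d\<close> in
    \<open>E\<close>, so they commute modulo the iterated centralizer by \<open>A\<close> at
    \<open>Suc j\<close>; then \<open>[a, d^k]\<close> is the \<open>k\<close>th power of
    \<open>?w\<close> there.\<close>
  have wpow: "commutator G a (d [^] (k::nat)) \<otimes> inv (?w [^] k) \<in> iterated_centralizer G P ?Ts"
    for k
  proof -
    let ?\<pi> = "(#>) (iterated_centralizer G P ?Ts)"
    let ?M = "G Mod iterated_centralizer G P ?Ts"
    have "commutator G ?w d \<in> iterated_centralizer G P ?Ts"
      using A[of "Suc j"] j wL[OF d] d unfolding kills_def by auto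
    then have "commutator ?M (?\<pi> a) (?\<pi> d) \<otimes>\<^bsub>?M\<^esub> ?\<pi> d = ?\<pi> d \<otimes>\<^bsub>?M\<^esub> commutator ?M (?\<pi> a) (?\<pi> d)"
      using Q.commutator_mem_iff[of ?w d] Qh.hom_commutator[OF ac dc] dc ac by simp
    then have "commutator ?M (?\<pi> a) (?\<pi> d [^]\<^bsub>?M\<^esub> k) = commutator ?M (?\<pi> a) (?\<pi> d) [^]\<^bsub>?M\<^esub> k"
      using Qh.H.commuting_commutator_pow ac dc Qh.hom_closed by blast
    then have "?\<pi> (commutator G a (d [^] k)) = ?\<pi> (?w [^] k)"
      using ac dc by (simp add: Qh.hom_commutator Qh.hom_nat_pow)
    then have "?\<pi> (commutator G a (d [^] k) \<otimes> inv (?w [^] k)) = \<one>\<^bsub>?M\<^esub>"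
      using ac dc by (simp del: mult_FactGroup one_FactGroup)
    moreover have "commutator G a (d [^] k) \<otimes> inv (?w [^] k) \<in> carrier G" using ac dc by simp
    ultimately show ?thesis using Q.rcos_eq_one_iff by blast
  qed
  have drop_drop: "drop (Suc i) ?Ts = drop (Suc (Suc j + i)) Ss" for i by (simp add: add.commute)
  \<comment> \<open>The later entries act multiplicatively along the chain
    \<open>L (Suc j + i) \<inter> E\<close>: a commutator of consecutive members is killed by
    \<open>A\<close>, since one factor lies in a later \<open>L\<close> and the other in
    \<open>E\<close>.\<close>
  have lin: "foldl (commutator G) (commutator G a (d [^] (k::nat))) zs
      \<otimes> inv (foldl (commutator G) ?w zs [^] k) \<in> P" if zs: "zs \<in> listset ?Ts" for zs k
  proof (rule foldl_commutator_pow_mod[where H = "\<lambda>i. L (Suc j + i) \<inter> E", OF P _ _ _ _ _ _ wpow zs])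
    show "normal_subset S G" if "S \<in> set ?Ts" for S using that normal_S by (meson in_set_dropD)
    show "subgroup (L (Suc j + i) \<inter> E) G" for i
      by (intro subgroups_Inter_pair normal_imp_subgroup E normal_L)
    show "commutator G x z \<in> L (Suc j + Suc i) \<inter> E"
      if "i < length ?Ts" "x \<in> L (Suc j + i) \<inter> E" "z \<in> ?Ts ! i" for i x z
    proof -
      have ij: "Suc j + i < r" using that by (simp add: r_def)
      have z: "z \<in> Ss ! (Suc j + i)" using that by (simp add: r_def)
      then have "z \<in> carrier G" "z \<in> N (Suc j + i)" using nth_S_carrier S_subset_N ij by blast+
      then show ?thesis
        using commutator_L[OF _ ij, of x z] commutator_mem_normal_left[OF E, of x z] that(2) by auto
    qed
    show "commutator G x y \<in> iterated_centralizer G P (drop (Suc i) ?Ts)"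
      if "i < length ?Ts" "x \<in> L (Suc j + Suc i) \<inter> E" "y \<in> L (Suc j + i) \<inter> E" for i x y
    proof -
      have "kills E P (Suc (Suc j + i))" using A[of "Suc (Suc j + i)"] that(1) by (simp add: r_def)
      then show ?thesis using that(2,3) unfolding drop_drop kills_def by auto
    qed
    show "commutator G a (d [^] k) \<in> L (Suc j + 0) \<inter> E" "?w \<in> L (Suc j + 0) \<inter> E"
      using wL d dpow by auto
  qed
  have "foldl (commutator G) ?w zs \<in> ?R" if zs: "zs \<in> listset ?Ts" for zs
  proof -
    let ?u = "foldl (commutator G) ?w zs"
    have zsc: "set zs \<subseteq> carrier G"
      using zs S_carrier by (meson in_set_dropD mem_listset_carrier)
    have uc: "?u \<in> carrier G" using zsc ac dc foldl_commutator_closed by simp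
    have uK: "?u \<in> K"
    proof -
      \<comment> \<open>Each entry of \<open>zs\<close> climbs one level in the chain
        \<open>L\<close>, and the list is just long enough to reach \<open>L r\<close>, that is
        \<open>K\<close>.\<close>
      have "foldl (commutator G) g zs' \<in> L (i + length zs')"
        if "g \<in> L i" "zs' \<in> listset (drop i Ss)" "1 \<le> i" "i \<le> r" for g zs' i
        using that
      proof (induction zs' arbitrary: g i)
        case (Cons z zs')
        have "i < r" using Cons.prems by (cases "i = r") (auto simp: r_def)
        then have "z \<in> Ss ! i" "zs' \<in> listset (drop (Suc i) Ss)"
          using Cons.prems(2) by (auto simp: r_def Cons_nth_drop_Suc[symmetric] set_Cons_def)
        then show ?case
          using Cons.IH[of "commutator G g z" "Suc i"] Cons.prems \<open>i < r\<close>
            commutator_L[of i g z] S_subset_N by auto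
      qed simp
      from this[of ?w "Suc j" zs] have "?u \<in> L (Suc j + length zs)" using wL[OF d] zs j by simp
      moreover have "Suc j + length zs = r"
        using list_all2_lengthD[of "(\<in>)" zs ?Ts] zs j by (simp add: mem_listset_iff r_def)
      ultimately show ?thesis unfolding K_def by (rule back_subst[of "\<lambda>i. _ \<in> L i"])
    qed
    have "?u [^] e0 \<in> P"
    proof (rule pow_values_mod[OF P j(2) uc])
      fix k
      have "d [^] (ns ! j * k) = (d [^] k) [^] (ns ! j)"
        using dc by (simp add: nat_pow_pow mult.commute)
      then have "d [^] (ns ! j * k) \<in> Ss ! j"
        using pow_S[of j "d [^] k"] dpow[of k] j by (simp add: N_def r_def)
      then have "xs @ d [^] (ns ! j * k) # zs \<in> listset Ss"
        using listset_split j xs zs by blast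
      then have "foldl (commutator G) (commutator G a (d [^] (ns ! j * k))) zs
          \<in> word_values (gamma G) Ss"
        using gamma_append[OF xs_ne, of G "d [^] (ns ! j * k) # zs"] xs
        unfolding word_values_def by (metis foldl_Cons image_eqI)
      then show "\<exists>v\<in>word_values (gamma G) Ss. v \<otimes> inv (?u [^] (ns ! j * k)) \<in> P"
        using lin[OF zs] by blast
    qed
    then show ?thesis using uK by (simp add: roots_def)
  qed
  moreover have "S \<subseteq> carrier G" if "S \<in> set ?Ts" for S
    using that S_carrier in_set_dropD by metis
  ultimately have "?w \<in> iterated_centralizer G ?R ?Ts"
    using mem_iterated_centralizer_iff[of ?R ?w ?Ts] ac dc subgroup.subset[OF normal_imp_subgroup[OF R]]
    by blast
  then show "commutator G a b \<in> iterated_centralizer G ?R ?Ts" by (simp add: b)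
qed

end

section \<open>Powers in the derived subgroup\<close>

text \<open>\<open>derived\<close> is generated by the elements \<open>a b a^-1 b^-1\<close>; the
  convention \<open>x^-1 y^-1 x y\<close> is matched by taking \<open>a\<close> and \<open>b\<close>
  to be the inverses of \<open>x\<close> and \<open>y\<close>.\<close>

lemma (in group) commutator_mem_derived:
  assumes "x \<in> K" "y \<in> K" "subgroup K G"
  shows "commutator G x y \<in> derived G K"
proof -
  have "inv x \<in> K" "inv y \<in> K" "x \<in> carrier G" "y \<in> carrier G"
    using assms subgroup.m_inv_closed subgroup.mem_carrier by metis+
  moreover from this have "commutator G x y = inv x \<otimes> inv y \<otimes> inv (inv x) \<otimes> inv (inv y)"
    by (simp add: commutator_def)
  ultimately show ?thesis
    unfolding derived_def by (intro generate.incl) blast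
qed

context finite_gamma_values
begin

lemma K_pow_closed: "k \<in> K \<Longrightarrow> k [^] (n::nat) \<in> K"
  by (rule subgroup_nat_pow_closed[OF normal_imp_subgroup[OF normal_K]])

text \<open>Each step of the downward induction on the position costs one factor \<open>e0\<close> in the exponent.\<close>

lemma K_pow_mem_of_centralized:
  assumes l: "1 \<le> l" "l < r" and P: "P \<lhd> G" "P \<subseteq> K"
    and NP: "\<And>k y. k \<in> K \<Longrightarrow> y \<in> N l \<Longrightarrow> commutator G k y \<in> P"
    and k: "k \<in> K"
  shows "k [^] (e0 ^ Suc r) \<in> P"
proof -
  \<comment> \<open>\<open>R t\<close> is \<open>P\<close> after \<open>t\<close> factors
    \<open>e0\<close> have been paid; these form an increasing chain of normal subgroups.\<close>
  define R where "R t = roots G K (e0 ^ t) P" for t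
  have subP: "subgroup P G" and subK: "subgroup K G"
    using P normal_K normal_imp_subgroup by blast+
  have KP: "commutator G x y \<in> P" if "x \<in> K" "y \<in> K" for x y
    using NP that K_subset_N[OF l(2)] by blast
  have PR: "P \<subseteq> R t" for t
    using P(2) subgroup_nat_pow_closed[OF subP] by (auto simp: R_def roots_def)
  have KR: "commutator G x y \<in> R t" if "x \<in> K" "y \<in> K" for x y t
    using KP PR that by blast
  have R: "R t \<lhd> G" for t
    unfolding R_def by (intro normal_roots normal_K P KP)
  have RSuc: "R (Suc t) = roots G K e0 (R t)" for t
    by (simp add: R_def roots_roots[OF subK])
  have Rmono: "R t \<subseteq> R (Suc t)" for t
    using subgroup_nat_pow_closed[OF normal_imp_subgroup[OF R[of t]]]
    unfolding RSuc by (auto simp: roots_def R_def)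
  have E: "N l \<lhd> G" using normal_N l by blast
  \<comment> \<open>Induction on the number \<open>t\<close> of factors paid: position
    \<open>j\<close> needs \<open>r - j\<close> of them, and the base \<open>j = r\<close> is the
    hypothesis \<open>NP\<close>.\<close>
  have kills: "kills (N l) (R t) j" if "1 \<le> j" "j \<le> r" "r \<le> j + t" for t j
    using that
  proof (induction t arbitrary: j)
    case 0
    then have "j = r" by simp
    moreover have "commutator G g e \<in> R 0" if "g \<in> L r" "e \<in> N l" for g e
      using NP that PR[of 0] unfolding K_def by blast
    ultimately show ?case by (simp add: kills_def r_def)
  next
    case (Suc t)
    show ?case
    proof (cases "r \<le> j + t")
      case True
      then show ?thesis using Suc kills_mono[OF _ Rmono] by blast
    next
      case False
      then have j: "1 \<le> j" "j < r" using Suc.prems by auto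
      show ?thesis
      proof (rule kills_step[OF R E j])
        show "kills (N l) (R (Suc t)) (Suc j)"
          using Suc.IH[of "Suc j"] j Suc.prems by (intro kills_mono[OF _ Rmono]) simp
        show "commutator G q d \<in> iterated_centralizer G (R (Suc t)) (drop (Suc j) Ss)"
          if "q \<in> L j" "d \<in> N l \<inter> N j" for q d
          unfolding RSuc
        proof (rule commutator_killed[OF R E j KR _ that])
          show "kills (N l) (R t) i" if "j < i" "i \<le> r" for i
            using Suc that by simp
        qed
      qed
    qed
  qed
  \<comment> \<open>A last use of the power trick at position \<open>l\<close>: with
    \<open>E = N l\<close> the entry \<open>xs ! l\<close> itself can serve as \<open>d\<close>, so
    the whole value is caught. The condition \<open>1 \<le> l\<close> keeps \<open>take l xs\<close>
    nonempty.\<close>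
  have "gamma G xs \<in> R (Suc r)" if xs: "xs \<in> listset Ss" for xs
  proof -
    have len: "length xs = r"
      using xs list_all2_lengthD[of "(\<in>)" xs] by (simp add: mem_listset_iff r_def)
    have split: "xs = take l xs @ xs ! l # drop (Suc l) xs"
      using l len by (simp add: id_take_nth_drop)
    have t: "take l xs \<in> listset (take l Ss)" and d: "drop (Suc l) xs \<in> listset (drop (Suc l) Ss)"
      using xs by (simp_all add: mem_listset_iff list_all2_takeI list_all2_dropI)
    have q: "gamma G (take l xs) \<in> L l"
      using t unfolding L_def word_values_def by (blast intro: generate.incl)
    have "xs ! l \<in> Ss ! l"
      using xs l len by (auto simp: mem_listset_iff list_all2_conv_all_nth)
    then have y: "xs ! l \<in> N l \<inter> N l" using S_subset_N l by blast
    have kl: "\<And>i. l < i \<Longrightarrow> i \<le> r \<Longrightarrow> kills (N l) (R r) i" using kills by simp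
    have "commutator G (gamma G (take l xs)) (xs ! l)
        \<in> iterated_centralizer G (R (Suc r)) (drop (Suc l) Ss)"
      unfolding RSuc by (rule commutator_killed[OF R E l KR kl q y])
    moreover have "S \<subseteq> carrier G" if "S \<in> set (drop (Suc l) Ss)" for S
      using that S_carrier in_set_dropD by metis
    moreover have "commutator G (gamma G (take l xs)) (xs ! l) \<in> carrier G"
      using L_carrier[OF q] N_carrier[OF l(2)] y by blast
    ultimately have "foldl (commutator G) (commutator G (gamma G (take l xs)) (xs ! l)) (drop (Suc l) xs)
        \<in> R (Suc r)"
      using mem_iterated_centralizer_iff[OF subgroup.subset[OF normal_imp_subgroup[OF R]]] d by blast
    moreover have "take l xs \<noteq> []" using l len by auto
    ultimately show ?thesis
      using gamma_append[of "take l xs" G "xs ! l # drop (Suc l) xs"] split by simp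
  qed
  then have "K \<subseteq> R (Suc r)"
    unfolding K_eq word_values_def
    by (intro generate_subgroup_incl normal_imp_subgroup[OF R]) blast
  then show ?thesis using k by (auto simp: R_def roots_def)
qed

lemma normal_derived_K: "derived G K \<lhd> G"
  by (rule derived_is_normal[OF normal_K])

lemma commutator_mem_centralizer_derived:
  assumes "x \<in> K" "y \<in> K"
  shows "commutator G x y \<in> iterated_centralizer G (derived G K) (drop j Ss)"
proof -
  have "derived G K \<subseteq> iterated_centralizer G (derived G K) (drop j Ss)"
    by (intro subset_iterated_centralizer normal_derived_K) (auto dest: in_set_dropD intro: normal_S)
  then show ?thesis
    using commutator_mem_derived[OF assms normal_imp_subgroup[OF normal_K]] by blast
qed

text \<open>The power trick in the first entry: the powers of \<open>k\<close> lie in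
  \<open>N 0\<close>, and those with exponent divisible by \<open>ns ! 0\<close> lie in
  \<open>Ss ! 0\<close>. Commutation with the remaining entries is multiplicative modulo the derived
  subgroup along the constant chain \<open>K\<close>, because \<open>K\<close> is abelian
  there.\<close>

lemma K_pow_mem_centralizer:
  assumes k: "k \<in> K"
  shows "k [^] e0 \<in> iterated_centralizer G (derived G K) (drop (Suc 0) Ss)"
proof -
  let ?D = "derived G K" and ?Ts = "drop (Suc 0) Ss"
  interpret D: normal ?D G by (rule normal_derived_K)
  have kc: "k \<in> carrier G" using k K_carrier by blast
  have TsC: "S \<subseteq> carrier G" if "S \<in> set ?Ts" for S
    using that S_carrier in_set_dropD by metis
  have lin: "foldl (commutator G) (k [^] p) zs \<otimes> inv (foldl (commutator G) k zs [^] p) \<in> ?D"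
    if zs: "zs \<in> listset ?Ts" for zs and p :: nat
  proof (rule foldl_commutator_pow_mod[where H = "\<lambda>i. K", OF normal_derived_K _ _ _ _ _ _ _ zs])
    show "normal_subset S G" if "S \<in> set ?Ts" for S using that normal_S in_set_dropD by metis
    show "subgroup K G" by (rule normal_imp_subgroup[OF normal_K])
    show "commutator G x z \<in> K" if "i < length ?Ts" "x \<in> K" "z \<in> ?Ts ! i" for i x z
      using that commutator_mem_normal_left[OF normal_K, of x z] TsC nth_mem by blast
    show "commutator G x y \<in> iterated_centralizer G ?D (drop (Suc i) ?Ts)"
      if "x \<in> K" "y \<in> K" for i x y
      using commutator_mem_centralizer_derived[OF that, of "Suc (Suc i)"] by (simp add: add.commute)
    have "k [^] p \<otimes> inv (k [^] p) = \<one>" using kc by simp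
    then show "k [^] p \<otimes> inv (k [^] p) \<in> iterated_centralizer G ?D ?Ts"
      using subgroup.one_closed[OF normal_imp_subgroup[OF iterated_centralizer_normal[OF normal_derived_K]]]
      by simp
  qed (use k K_pow_closed in auto)
  have "foldl (commutator G) (k [^] e0) zs \<in> ?D" if zs: "zs \<in> listset ?Ts" for zs
  proof -
    let ?u = "foldl (commutator G) k zs" and ?v = "foldl (commutator G) (k [^] e0) zs"
    have zsc: "set zs \<subseteq> carrier G" using zs TsC mem_listset_carrier by metis
    have uc: "?u \<in> carrier G" "?v \<in> carrier G" using zsc kc foldl_commutator_closed by auto
    have "?u [^] e0 \<in> ?D"
    proof (rule pow_values_mod[OF normal_derived_K, of 0])
      show "0 < r" using r_pos by simp
      show "?u \<in> carrier G" by fact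
      fix i
      have "k [^] (ns ! 0 * i) = (k [^] i) [^] (ns ! 0)"
        using kc by (simp add: nat_pow_pow mult.commute)
      moreover have "k [^] i \<in> generate G (Ss ! 0)"
        using K_pow_closed[OF k] K_subset_N[of 0] r_pos by (auto simp: N_def)
      ultimately have "k [^] (ns ! 0 * i) \<in> Ss ! 0"
        using pow_S[of 0] Ss_nonempty by simp
      then have "[] @ k [^] (ns ! 0 * i) # zs \<in> listset Ss"
        using listset_split[of 0 "[]"] zs r_pos by simp
      then have "foldl (commutator G) (k [^] (ns ! 0 * i)) zs \<in> word_values (gamma G) Ss"
        unfolding word_values_def by (metis append_Nil gamma.simps(2) image_eqI)
      then show "\<exists>v\<in>word_values (gamma G) Ss. v \<otimes> inv (?u [^] (ns ! 0 * i)) \<in> ?D"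
        using lin[OF zs] by blast
    qed
    then have "?v \<otimes> inv (?u [^] e0) \<otimes> ?u [^] e0 \<in> ?D"
      using lin[OF zs, of e0] by blast
    then show ?thesis using uc by (simp add: m_assoc)
  qed
  then show ?thesis
    using mem_iterated_centralizer_iff[OF D.subset, of "k [^] e0" ?Ts] kc TsC by blast
qed

text \<open>Each step removes one entry from the centralizer. If \<open>x^e\<close> is centralized
  by \<open>N l\<close> modulo \<open>?Q\<close>, then \<open>[x, y]^e\<close> lies in
  \<open>?Q\<close>, so \<open>[K, N l]\<close> lies in a group of roots;
  \<open>K_pow_mem_of_centralized\<close> brings \<open>K\<close> into these roots at the cost of
  \<open>e0 ^ Suc r\<close>. For \<open>j = r - 1\<close> no entry is left and the centralizer is
  the derived subgroup.\<close>

lemma K_pow_mem_centralizer_drop: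
  assumes "j < r" "k \<in> K"
  shows "k [^] (e0 * (e0 ^ Suc r) ^ j) \<in> iterated_centralizer G (derived G K) (drop (Suc j) Ss)"
  using assms
proof (induction j arbitrary: k)
  case 0
  then show ?case using K_pow_mem_centralizer by simp
next
  case (Suc j)
  define e where "e = e0 * (e0 ^ Suc r) ^ j"
  define l where "l = Suc j"
  let ?Q = "iterated_centralizer G (derived G K) (drop (Suc l) Ss)"
  have l: "1 \<le> l" "l < r" using Suc.prems by (auto simp: l_def)
  have Q: "?Q \<lhd> G" by (rule iterated_centralizer_normal[OF normal_derived_K])
  interpret Q: normal ?Q G by (rule Q)
  interpret p: group_hom G "G Mod ?Q" "(#>) ?Q" by (rule Q.group_hom_Mod)
  have KQ: "commutator G x y \<in> ?Q" if "x \<in> K" "y \<in> K" for x y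
    using commutator_mem_centralizer_derived that by blast
  have drop: "drop l Ss = Ss ! l # drop (Suc l) Ss" using l by (simp add: Cons_nth_drop_Suc r_def)
  have "commutator G x y \<in> roots G K e ?Q" if x: "x \<in> K" and y: "y \<in> N l" for x y
  proof -
    have xc: "x \<in> carrier G" and yc: "y \<in> carrier G" using x y K_carrier N_carrier l by blast+
    have "x [^] e \<in> iterated_centralizer G (derived G K) (drop l Ss)"
      using Suc.IH[OF _ x] l unfolding e_def l_def by simp
    then have 1: "\<forall>z\<in>Ss ! l. commutator G (x [^] e) z \<in> ?Q" unfolding drop by simp
    have xe: "commutator G (x [^] e) y \<in> ?Q"
    proof (rule Q.commutator_generate[of "{x [^] e}" "Ss ! l"])
      show "y \<in> generate G (Ss ! l)" using y by (simp add: N_def)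
    qed (use 1 xc nth_S_carrier l in \<open>auto intro: generate.incl\<close>)
    \<comment> \<open>\<open>[x, y]\<close> is the product of \<open>x^-1\<close> and
      \<open>y^-1 x y\<close>, both in \<open>K\<close>. They commute modulo \<open>?Q\<close>, so
      its \<open>e\<close>th power is \<open>[x^e, y]\<close> modulo \<open>?Q\<close>.\<close>
    let ?x = "inv x" and ?z = "inv y \<otimes> x \<otimes> y"
    have xK: "?x \<in> K" "?z \<in> K"
      using x normal_conj_mem[OF normal_K yc x] subgroup.m_inv_closed[OF normal_imp_subgroup[OF normal_K]]
      by auto
    have cc: "?x \<in> carrier G" "?z \<in> carrier G" using xc yc by auto
    have c: "commutator G x y = ?x \<otimes> ?z" using xc yc by (simp add: commutator_def m_assoc)
    have ze: "?z [^] e = inv y \<otimes> x [^] e \<otimes> y"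
      using conj_nat_pow[of "inv y" x e] xc yc by simp
    have "?Q #> (commutator G x y [^] e) = ((?Q #> ?x) \<otimes>\<^bsub>G Mod ?Q\<^esub> (?Q #> ?z)) [^]\<^bsub>G Mod ?Q\<^esub> e"
      using c cc p.hom_nat_pow p.hom_mult by (metis m_closed)
    also have "\<dots> = (?Q #> ?x) [^]\<^bsub>G Mod ?Q\<^esub> e \<otimes>\<^bsub>G Mod ?Q\<^esub> (?Q #> ?z) [^]\<^bsub>G Mod ?Q\<^esub> e"
      using KQ[OF xK] Q.commutator_mem_iff[OF cc] p.hom_closed cc
      by (intro p.H.pow_mult_distrib) blast+
    also have "\<dots> = ?Q #> (?x [^] e \<otimes> ?z [^] e)"
      using p.hom_nat_pow p.hom_mult cc by (metis nat_pow_closed)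
    also have "?x [^] e \<otimes> ?z [^] e = commutator G (x [^] e) y"
      unfolding ze using xc yc by (simp add: nat_pow_inv commutator_def m_assoc)
    also have "?Q #> \<dots> = \<one>\<^bsub>G Mod ?Q\<^esub>"
      using xe xc yc by (intro Q.rcos_eq_one_iff[THEN iffD2]) auto
    finally have "commutator G x y [^] e \<in> ?Q"
      using Q.rcos_eq_one_iff[of "commutator G x y [^] e"] xc yc by simp
    then show ?thesis
      using commutator_mem_normal_left[OF normal_K x yc] by (simp add: roots_def)
  qed
  moreover have "roots G K e ?Q \<lhd> G" by (intro normal_roots normal_K Q KQ)
  moreover have "roots G K e ?Q \<subseteq> K" by (auto simp: roots_def)
  ultimately have "k [^] (e0 ^ Suc r) \<in> roots G K e ?Q"
    using K_pow_mem_of_centralized[OF l] Suc.prems(2) by blast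
  then have "k [^] (e0 ^ Suc r * e) \<in> ?Q"
    using K_carrier[OF Suc.prems(2)] by (simp add: roots_def nat_pow_pow)
  then show ?case by (simp add: e_def l_def mult_ac)
qed

lemma K_pow_mem_derived:
  assumes "k \<in> K"
  shows "k [^] (e0 * (e0 ^ Suc r) ^ (r - 1)) \<in> derived G K"
  using K_pow_mem_centralizer_drop[of "r - 1" k] assms r_pos by (simp add: r_def)

end

section \<open>Transfer and Dietzmann's lemma\<close>

context group
begin

text \<open>The transfer homomorphism into a central subgroup \<open>Z\<close> of finite index \<open>n\<close> restricts to \<open>x \<mapsto> x\<^sup>n\<close>
  on \<open>Z\<close>, and it is trivial on the derived subgroup because \<open>Z\<close> is commutative.\<close>

lemma central_derived_pow_index:
  assumes Z: "subgroup Z G" and central: "\<And>z g. z \<in> Z \<Longrightarrow> g \<in> carrier G \<Longrightarrow> z \<otimes> g = g \<otimes> z"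
    and x: "x \<in> Z" "x \<in> derived G (carrier G)"
  shows "x [^] card (rcosets Z) = \<one>"
proof -
  interpret Z: subgroup Z G by fact
  let ?Z = "G\<lparr>carrier := Z\<rparr>"
  interpret ZG: group ?Z using Z subgroup_imp_group by blast
  interpret ZC: comm_group ?Z
    by (rule ZG.group_comm_groupI) (use central in auto)
  let ?R = "rcosets Z"
  define s where "s c = (SOME y. y \<in> c)" for c :: "'a set"
  have s: "s c \<in> c" "s c \<in> carrier G" "Z #> s c = c" if cR: "c \<in> ?R" for c
  proof -
    show 1: "s c \<in> c" unfolding s_def using Z.rcosets_non_empty[OF cR] by (simp add: some_in_eq)
    show 2: "s c \<in> carrier G" using 1 Z.rcosets_carrier[OF is_group cR] by blast
    obtain g where "g \<in> carrier G" "c = Z #> g" using cR by (auto simp: RCOSETS_def)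
    then show "Z #> s c = c" using repr_independence[OF _ _ Z, of "s c" g] 1 by simp
  qed
  have act: "c #> k \<in> ?R" if "c \<in> ?R" "k \<in> carrier G" for c k
  proof -
    have "c #> k = Z #> (s c \<otimes> k)" using coset_mult_assoc[OF Z.subset, of "s c" k] s[OF that(1)] that by simp
    then show ?thesis using s[OF that(1)] that by (simp add: rcosetsI Z.subset)
  qed
  have act_mult: "c #> k #> l = c #> (k \<otimes> l)"
    if "c \<in> ?R" "k \<in> carrier G" "l \<in> carrier G" for c k l
    using coset_mult_assoc Z.rcosets_carrier[OF is_group that(1)] that by blast
  have act_one: "c #> \<one> = c" if "c \<in> ?R" for c
    using Z.rcosets_carrier[OF is_group that] by simp
  have bij: "(\<lambda>c. c #> k) ` ?R = ?R" "inj_on (\<lambda>c. c #> k) ?R" if k: "k \<in> carrier G" for k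
  proof -
    have inv: "c #> inv k #> k = c" "c #> k #> inv k = c" if "c \<in> ?R" for c
      using act_mult act_one that k by auto
    show "(\<lambda>c. c #> k) ` ?R = ?R"
    proof
      show "?R \<subseteq> (\<lambda>c. c #> k) ` ?R"
      proof
        fix c assume c: "c \<in> ?R"
        show "c \<in> (\<lambda>c. c #> k) ` ?R"
          by (rule image_eqI[of _ _ "c #> inv k"]) (simp_all only: inv(1) c act k inv_closed)
      qed
    qed (use act k in blast)
    show "inj_on (\<lambda>c. c #> k) ?R" by (rule inj_on_inverseI[of _ "\<lambda>c. c #> inv k"]) (rule inv(2))
  qed
  \<comment> \<open>The transfer factor: it compares the translate by \<open>k\<close> of the
    representative of \<open>c\<close> with the representative of the translated coset.\<close>
  define h where "h k c = s c \<otimes> k \<otimes> inv s (c #> k)" for k c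
  have h: "h k c \<in> Z" if "c \<in> ?R" "k \<in> carrier G" for k c
  proof -
    have "s c \<otimes> k \<in> c #> k" using s[OF that(1)] by (auto simp: r_coset_def)
    then have "s c \<otimes> k \<in> Z #> s (c #> k)" using s(3)[OF act[OF that]] by simp
    then show ?thesis
      unfolding h_def
      by (subst Z.rcos_module[OF is_group s(2)[OF act[OF that]], symmetric]) (use s(2) that in auto)
  qed
  \<comment> \<open>For an infinite set of cosets \<open>finprod\<close> takes the default value
    \<open>\<one>\<close> and \<open>card\<close> is \<open>0\<close>, in agreement with
    \<open>\<tau> x = x [^] card ?R\<close>.\<close>
  define \<tau> where "\<tau> k = finprod ?Z (h k) ?R" for k
  have \<tau>_closed: "\<tau> k \<in> Z" if "k \<in> carrier G" for k
    using ZC.finprod_closed[of "h k" ?R] h that by (auto simp: \<tau>_def)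
  have \<tau>_mult: "\<tau> (k \<otimes> l) = \<tau> k \<otimes> \<tau> l" if k: "k \<in> carrier G" and l: "l \<in> carrier G" for k l
  proof -
    have hh: "h (k \<otimes> l) c = h k c \<otimes> h l (c #> k)" if "c \<in> ?R" for c
      unfolding h_def using s(2) act act_mult that k l by (simp add: word_simps)
    have "\<tau> (k \<otimes> l) = finprod ?Z (\<lambda>c. h k c \<otimes>\<^bsub>?Z\<^esub> h l (c #> k)) ?R"
      unfolding \<tau>_def using hh h act k l by (intro ZC.finprod_cong') auto
    also have "\<dots> = finprod ?Z (h k) ?R \<otimes>\<^bsub>?Z\<^esub> finprod ?Z (\<lambda>c. h l (c #> k)) ?R"
      using h act k l by (intro ZC.finprod_multf) auto
    \<comment> \<open>Translation by \<open>k\<close> permutes the cosets, so the product can be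
      reindexed to give \<open>\<tau> l\<close>.\<close>
    also have "finprod ?Z (\<lambda>c. h l (c #> k)) ?R = finprod ?Z (h l) ((\<lambda>c. c #> k) ` ?R)"
      using bij[OF k] h l by (intro ZC.finprod_reindex[symmetric]) auto
    finally show ?thesis by (simp add: \<tau>_def bij[OF k])
  qed
  interpret \<tau>: group_hom G ?Z \<tau>
    by unfold_locales (auto simp: hom_def \<tau>_closed \<tau>_mult)
  have "derived G (carrier G) \<subseteq> kernel G ?Z \<tau>"
    unfolding derived_def
  proof (rule generate_subgroup_incl[OF _ \<tau>.subgroup_kernel])
    have "\<tau> (a \<otimes> b \<otimes> inv a \<otimes> inv b) = \<one>" if a: "a \<in> carrier G" and b: "b \<in> carrier G" for a b
    proof -
      have ab: "\<tau> a \<in> Z" "\<tau> b \<in> Z" "\<tau> (inv a) \<in> Z" "\<tau> (inv b) \<in> Z" using \<tau>_closed a b inv_closed by blast+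
      have inv: "\<tau> k \<otimes> \<tau> (inv k) = \<one>" if "k \<in> carrier G" for k
        using \<tau>_mult[OF that inv_closed[OF that]] \<tau>.hom_one that by (simp del: \<tau>.hom_inv)
      have "\<tau> (a \<otimes> b \<otimes> inv a \<otimes> inv b) = \<tau> a \<otimes> (\<tau> b \<otimes> \<tau> (inv a)) \<otimes> \<tau> (inv b)"
        using a b ab by (simp add: \<tau>_mult m_assoc Z.mem_carrier del: \<tau>.hom_inv)
      also have "\<tau> b \<otimes> \<tau> (inv a) = \<tau> (inv a) \<otimes> \<tau> b"
        by (rule central[OF ab(2) Z.mem_carrier[OF ab(3)]])
      also have "\<tau> a \<otimes> (\<tau> (inv a) \<otimes> \<tau> b) \<otimes> \<tau> (inv b) = (\<tau> a \<otimes> \<tau> (inv a)) \<otimes> (\<tau> b \<otimes> \<tau> (inv b))"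
        using ab by (simp add: m_assoc Z.mem_carrier del: \<tau>.hom_inv)
      finally show ?thesis by (simp add: inv a b del: \<tau>.hom_inv)
    qed
    then show "derived_set G (carrier G) \<subseteq> kernel G ?Z \<tau>" by (auto simp: kernel_def)
  qed
  then have "\<tau> x = \<one>" using x by (auto simp: kernel_def)
  moreover have "\<tau> x = x [^] card ?R"
  proof -
    have xc: "x \<in> carrier G" using x by simp
    \<comment> \<open>A central \<open>x\<close> in \<open>Z\<close> fixes every coset, so the same
      representative occurs on both sides and cancels.\<close>
    have "h x c = x" if c: "c \<in> ?R" for c
    proof -
      have "c #> x = Z #> (s c \<otimes> x)"
        using coset_mult_assoc[OF Z.subset, of "s c" x] s[OF c] xc by simp
      also have "\<dots> = Z #> x #> s c"
        using central[OF x(1) s(2)[OF c]] coset_mult_assoc[OF Z.subset xc s(2)[OF c]] by simp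
      also have "\<dots> = c" using Z.rcos_const[OF is_group x(1)] s(3)[OF c] by simp
      finally have "h x c = s c \<otimes> x \<otimes> inv s c" by (simp add: h_def)
      also have "s c \<otimes> x = x \<otimes> s c" using central[OF x(1) s(2)[OF c]] by simp
      finally show ?thesis using xc s(2)[OF c] by (simp add: m_assoc)
    qed
    then have "\<tau> x = finprod ?Z (\<lambda>c. x) ?R"
      unfolding \<tau>_def using x by (intro ZC.finprod_cong') auto
    then show ?thesis using ZC.finprod_const[of x ?R] x nat_pow_consistent by simp
  qed
  ultimately show ?thesis by simp
qed

text \<open>Conjugation on the generating set \<open>X\<close> has the centre as kernel, so the
  centre has index at most \<open>m ^ m\<close>. The first factorial makes the power of
  \<open>k\<close> central, \<open>e\<close> places it in the derived subgroup, and the second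
  factorial is a multiple of the index, by which the transfer annihilates it.\<close>

lemma pow_eq_one_of_pow_mem_derived:
  assumes X: "normal_subset X G" "finite X" "card X \<le> m" and gen: "generate G X = carrier G"
    and k: "k \<in> carrier G" "k [^] (e::nat) \<in> derived G (carrier G)"
  shows "k [^] (e * fact (m ^ m) * fact (m ^ m)) = \<one>"
proof -
  have Xc: "X \<subseteq> carrier G" by (rule normal_subset_carrier[OF X(1)])
  \<comment> \<open>The centre, phrased by membership in \<open>{\<one>}\<close> so that
    \<open>normal_commuting\<close> applies.\<close>
  define Z where "Z = {z \<in> carrier G. \<forall>g\<in>carrier G. commutator G z g \<in> {\<one>}}"
  have one: "{\<one>} \<lhd> G" by (rule one_is_normal)
  have Z: "Z \<lhd> G"
    unfolding Z_def
    by (intro normal_commuting one normal_imp_normal_subset normal_self)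
  interpret Z: normal Z G by (rule Z)
  have mem_Z: "z \<in> Z" if z: "z \<in> carrier G" and c: "\<And>x. x \<in> X \<Longrightarrow> z \<otimes> x = x \<otimes> z" for z
  proof -
    have "commutator G z g \<in> {\<one>}" if "g \<in> carrier G" for g
    proof (rule normal.commutator_generate[OF one, of "{z}" X])
      show "commutator G a b \<in> {\<one>}" if "a \<in> {z}" "b \<in> X" for a b
      proof -
        have "b \<in> carrier G" "a = z" using that Xc by blast+
        then show ?thesis using commutator_eq_one_iff[OF z, of b, THEN iffD2, OF _ c[OF that(2)]] by blast
      qed
      show "z \<in> generate G {z}" by (rule generate.incl) simp
      show "g \<in> generate G X" unfolding gen by (rule that)
      show "{z} \<subseteq> carrier G" using z by blast
      show "X \<subseteq> carrier G" by (rule Xc)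
    qed
    then show ?thesis unfolding Z_def using z by blast
  qed
  \<comment> \<open>The conjugation action as an extensional map on \<open>X\<close>, so that such
    maps can be counted. Elements acting alike differ by an element commuting with \<open>X\<close>,
    which is central since \<open>X\<close> generates.\<close>
  define F where "F g = (\<lambda>x\<in>X. inv g \<otimes> x \<otimes> g)" for g
  have F: "F g \<in> X \<rightarrow>\<^sub>E X" if "g \<in> carrier G" for g
    using that normal_subset_conj[OF X(1)] by (auto simp: F_def)
  have F_eq: "Z #> g = Z #> l" if g: "g \<in> carrier G" and l: "l \<in> carrier G" and eq: "F g = F l" for g l
  proof -
    have "g \<otimes> inv l \<in> Z"
    proof (rule mem_Z)
      fix x assume x: "x \<in> X"
      then have xc: "x \<in> carrier G" using Xc by blast
      have "inv g \<otimes> x \<otimes> g = inv l \<otimes> x \<otimes> l"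
        using fun_cong[OF eq, of x] x by (simp add: F_def)
      then have "g \<otimes> (inv g \<otimes> x \<otimes> g) \<otimes> inv l = g \<otimes> (inv l \<otimes> x \<otimes> l) \<otimes> inv l" by simp
      then show "g \<otimes> inv l \<otimes> x = x \<otimes> (g \<otimes> inv l)"
        using g l xc by (simp add: word_simps)
    qed (use g l in simp)
    then have "g \<in> Z #> l" using Z.rcos_module[OF is_group l g] by blast
    then show ?thesis using repr_independence[OF _ l Z.subgroup_axioms] by simp
  qed
  have cosets: "rcosets Z = (\<lambda>f. Z #> (SOME g. g \<in> carrier G \<and> F g = f)) ` (F ` carrier G)"
  proof -
    have "Z #> (SOME g'. g' \<in> carrier G \<and> F g' = F g) = Z #> g" if "g \<in> carrier G" for g
      using someI[of "\<lambda>g'. g' \<in> carrier G \<and> F g' = F g" g] that F_eq by blast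
    then show ?thesis unfolding RCOSETS_def image_image by auto
  qed
  have finE: "finite (X \<rightarrow>\<^sub>E X)" using X by (simp add: finite_PiE)
  have FE: "F ` carrier G \<subseteq> X \<rightarrow>\<^sub>E X" using F by blast
  have finR: "finite (rcosets Z)"
    unfolding cosets using finite_subset[OF FE finE] by blast
  have "card (rcosets Z) \<le> card (F ` carrier G)"
    unfolding cosets using finite_subset[OF FE finE] by (rule card_image_le)
  also have "\<dots> \<le> card (X \<rightarrow>\<^sub>E X)" by (rule card_mono[OF finE FE])
  also have "\<dots> = card X ^ card X" using X by (simp add: card_PiE)
  also have "\<dots> \<le> m ^ m"
  \<comment> \<open>Monotonicity in the exponent needs a base of at least \<open>1\<close>; the
    value \<open>0 ^ 0 = 1\<close> is handled apart.\<close>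
  proof (cases "card X = 0")
    case True
    then show ?thesis by (cases "m = 0") auto
  next
    case False
    have "card X ^ card X \<le> m ^ card X" using X(3) by (rule power_mono) simp
    also have "\<dots> \<le> m ^ m" using X(3) False by (intro power_increasing) auto
    finally show ?thesis .
  qed
  finally have card: "card (rcosets Z) \<le> m ^ m" .
  have "card (rcosets Z) > 0" using finR Z.subgroup_in_rcosets[OF is_group] by (auto simp: card_gt_0_iff)
  then have dvd: "card (rcosets Z) dvd fact (m ^ m)" using card by (simp add: dvd_fact)
  interpret p: group_hom G "G Mod Z" "(#>) Z" by (rule Z.group_hom_Mod)
  have "(Z #> k) [^]\<^bsub>G Mod Z\<^esub> (1 * fact (m ^ m) :: nat) = \<one>\<^bsub>G Mod Z\<^esub>"
  proof (rule p.H.pow_finite_range)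
    have c: "carrier (G Mod Z) = rcosets Z" by (simp add: FactGroup_def)
    show "finite (carrier (G Mod Z))" "card (carrier (G Mod Z)) \<le> m ^ m"
      using finR card by (simp_all add: c)
    show "(Z #> k) [^]\<^bsub>G Mod Z\<^esub> (1 * i) \<in> carrier (G Mod Z)" for i :: nat
      by (intro p.H.nat_pow_closed p.hom_closed k)
  qed (intro p.hom_closed k)
  then have kZ: "k [^] (fact (m ^ m) :: nat) \<in> Z"
    using Z.rcos_eq_one_iff[of "k [^] (fact (m ^ m) :: nat)"] p.hom_nat_pow k by simp
  let ?x = "k [^] (e * fact (m ^ m))"
  have "?x [^] card (rcosets Z) = \<one>"
  proof (rule central_derived_pow_index[OF Z.subgroup_axioms])
    show "z \<otimes> g = g \<otimes> z" if "z \<in> Z" "g \<in> carrier G" for z g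
    proof -
      have "z \<in> carrier G" "commutator G z g = \<one>" using that unfolding Z_def by blast+
      then show ?thesis using commutator_eq_one_iff that(2) by blast
    qed
    show "?x \<in> Z" by (rule pow_mem_of_dvd[OF Z.subgroup_axioms k(1) kZ]) simp
    show "?x \<in> derived G (carrier G)"
      by (rule pow_mem_of_dvd[OF derived_is_subgroup k]) simp_all
  qed
  then show ?thesis
    using pow_mem_of_dvd[OF triv_subgroup, of ?x "card (rcosets Z)"] dvd k(1)
    by (simp add: nat_pow_pow)
qed

section \<open>Words over a normal subset\<close>

abbreviation word_product :: "'a list \<Rightarrow> 'a"
  where "word_product ws \<equiv> foldr (\<otimes>) ws \<one>"

lemma word_product_closed: "set ws \<subseteq> carrier G \<Longrightarrow> word_product ws \<in> carrier G"
  by (induction ws) auto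

lemma word_product_append:
  assumes "set us \<subseteq> carrier G" "set vs \<subseteq> carrier G"
  shows "word_product (us @ vs) = word_product us \<otimes> word_product vs"
  using assms by (induction us) (auto simp: m_assoc word_product_closed)

lemma word_product_conj:
  assumes "set us \<subseteq> carrier G" "x \<in> carrier G"
  shows "word_product (map (\<lambda>u. inv x \<otimes> u \<otimes> x) us) = inv x \<otimes> word_product us \<otimes> x"
  using assms by (induction us) (auto simp: word_simps word_product_closed)

text \<open>\<open>u x = x (x^-1 u x)\<close> moves \<open>x\<close> to the front and keeps the
  other letters in \<open>X\<close>. Taking the first occurrence ensures that no conjugated letter
  becomes \<open>x\<close>, so the count drops by exactly one.\<close>

lemma word_product_pull:
  assumes X: "normal_subset X G" and ws: "set ws \<subseteq> X" "x \<in> set ws"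
  shows "\<exists>ws'. set ws' \<subseteq> X \<and> word_product ws = x \<otimes> word_product ws' \<and>
    length ws = Suc (length ws') \<and> count_list ws x = Suc (count_list ws' x)"
proof -
  have Xc: "X \<subseteq> carrier G" by (rule normal_subset_carrier[OF X])
  obtain us vs where split: "ws = us @ x # vs" "x \<notin> set us"
    using split_list_first[OF ws(2)] by blast
  let ?us = "map (\<lambda>u. inv x \<otimes> u \<otimes> x) us"
  have x: "x \<in> X" "x \<in> carrier G" using ws Xc by auto
  have c: "set us \<subseteq> carrier G" "set vs \<subseteq> carrier G" "set (x # vs) \<subseteq> carrier G"
    using ws Xc split by auto
  have us: "set ?us \<subseteq> X" using normal_subset_conj[OF X x(2)] ws split by auto
  have "inv x \<otimes> u \<otimes> x \<noteq> x" if "u \<in> set us" for u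
  proof
    assume "inv x \<otimes> u \<otimes> x = x"
    then have "x \<otimes> (inv x \<otimes> u \<otimes> x) \<otimes> inv x = x \<otimes> x \<otimes> inv x" by simp
    then have "u = x" using that c x by (simp add: word_simps subset_iff)
    then show False using that split by simp
  qed
  then have "x \<notin> set ?us" by fastforce
  then have "count_list ?us x = 0" "count_list us x = 0" using split(2) by simp_all
  moreover have "word_product ws = x \<otimes> word_product (?us @ vs)"
  proof -
    have usc: "set ?us \<subseteq> carrier G" using us Xc by blast
    show ?thesis
      unfolding split(1) word_product_append[OF c(1,3)] word_product_append[OF usc c(2)]
        word_product_conj[OF c(1) x(2)]
      using c x by (simp add: word_simps word_product_closed)
  qed
  moreover have "set (?us @ vs) \<subseteq> X" using us ws split by simp
  ultimately show ?thesis
    by (intro exI[of _ "?us @ vs"]) (simp add: split(1))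
qed

lemma word_product_pull_pow:
  assumes X: "normal_subset X G" and ws: "set ws \<subseteq> X" "n \<le> count_list ws x" and x: "x \<in> carrier G"
  shows "\<exists>ws'. set ws' \<subseteq> X \<and> word_product ws = x [^] n \<otimes> word_product ws' \<and>
    length ws = n + length ws'"
  using ws
proof (induction n arbitrary: ws)
  case 0
  then show ?case
    using word_product_closed normal_subset_carrier[OF X] by (intro exI[of _ ws]) auto
next
  case (Suc n)
  have "x \<in> set ws" using Suc.prems count_list_0_iff[of ws x] by fastforce
  then obtain ws1 where 1: "set ws1 \<subseteq> X" "word_product ws = x \<otimes> word_product ws1"
      "length ws = Suc (length ws1)" "count_list ws x = Suc (count_list ws1 x)"
    using word_product_pull[OF X Suc.prems(1)] by blast
  obtain ws2 where 2: "set ws2 \<subseteq> X" "word_product ws1 = x [^] n \<otimes> word_product ws2"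
      "length ws1 = n + length ws2"
    using Suc.IH[OF 1(1)] 1(4) Suc.prems(2) by auto
  have "word_product ws2 \<in> carrier G"
    using word_product_closed 2(1) normal_subset_carrier[OF X] by blast
  then have "word_product ws = x [^] Suc n \<otimes> word_product ws2"
    unfolding 1(2) 2(2) using x by (simp only: nat_pow_Suc2) (simp add: m_assoc)
  then show ?case using 1(3) 2 by (intro exI[of _ ws2]) simp
qed

text \<open>Dietzmann's lemma: in a word of length more than \<open>|X| e\<close> some letter occurs \<open>e\<close> times, and these
  occurrences can be moved to the front, where they cancel.\<close>

lemma dietzmann:
  assumes X: "normal_subset X G" "finite X" "card X \<le> m"
    and e: "e > 0" "\<And>x. x \<in> X \<Longrightarrow> x [^] (e::nat) = \<one>"
  shows "finite (generate G X) \<and> card (generate G X) \<le> (\<Sum>i\<le>m * e. m ^ i)"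
proof -
  have Xc: "X \<subseteq> carrier G" by (rule normal_subset_carrier[OF X(1)])
  have short: "\<exists>vs. set vs \<subseteq> X \<and> word_product vs = word_product ws \<and> length vs \<le> card X * e"
    if "set ws \<subseteq> X" for ws
    using that
  proof (induction ws rule: length_induct)
    case (1 ws)
    show ?case
    proof (cases "length ws \<le> card X * e")
      case False
      have "\<exists>x\<in>X. e \<le> count_list ws x"
      proof (rule ccontr)
        assume "\<not> ?thesis"
        then have "sum (count_list ws) X \<le> (\<Sum>x\<in>X. e)" by (intro sum_mono) auto
        then show False using False sum_count_set[OF 1(2) X(2)] by simp
      qed
      then obtain x where x: "x \<in> X" "e \<le> count_list ws x" by blast
      then obtain ws' where ws': "set ws' \<subseteq> X" "word_product ws = x [^] e \<otimes> word_product ws'"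
          "length ws = e + length ws'"
        using word_product_pull_pow[OF X(1) 1(2)] Xc by blast
      have "word_product ws' \<in> carrier G" using word_product_closed ws'(1) Xc by blast
      then have "word_product ws = word_product ws'" using ws' e(2)[OF x(1)] by simp
      then show ?thesis using 1(1) ws'(1,3) e(1) by simp
    qed (use 1 in blast)
  qed
  have words: "\<exists>ws. set ws \<subseteq> X \<and> word_product ws = g" if "g \<in> generate G X" for g
    using that
  proof (induction g rule: generate.induct)
    case one
    show ?case by (intro exI[of _ "[]"]) simp
  next
    case (incl h)
    then show ?case using Xc by (intro exI[of _ "[h]"]) auto
  next
    \<comment> \<open>The exponent \<open>e\<close> replaces an inverse by the positive word
      \<open>h^(e - 1)\<close>.\<close>
    case (inv h)
    have hc: "h \<in> carrier G" using inv Xc by blast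
    have rep: "word_product (replicate n h) = h [^] n" for n
      using group_commutes_pow[OF refl hc hc] by (induction n) simp_all
    have "h [^] (e - 1) \<otimes> h = h [^] Suc (e - 1)" by simp
    also have "\<dots> = \<one>" using e(1) e(2)[OF inv] by (simp del: nat_pow_Suc)
    finally have "inv h = h [^] (e - 1)" using hc by (intro inv_equality) auto
    then show ?case using inv rep by (intro exI[of _ "replicate (e - 1) h"]) (auto dest: in_set_replicate[THEN iffD1])
  next
    case (eng h1 h2)
    then obtain us vs where "set us \<subseteq> X" "word_product us = h1" "set vs \<subseteq> X" "word_product vs = h2"
      by blast
    then show ?case using word_product_append[of us vs] Xc by (intro exI[of _ "us @ vs"]) auto
  qed
  let ?W = "{ws. set ws \<subseteq> X \<and> length ws \<le> card X * e}"
  have sub: "generate G X \<subseteq> word_product ` ?W"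
  proof
    fix g assume "g \<in> generate G X"
    then obtain ws where "set ws \<subseteq> X" "word_product ws = g" using words by blast
    then obtain vs where "vs \<in> ?W" "g = word_product vs" using short[of ws] by auto
    then show "g \<in> word_product ` ?W" by (rule rev_image_eqI)
  qed
  have fin: "finite ?W" by (rule finite_lists_length_le[OF X(2)])
  have "card (generate G X) \<le> card ?W" using surj_card_le[OF fin sub] .
  also have "\<dots> = (\<Sum>i\<le>card X * e. card X ^ i)" by (rule card_lists_length_le[OF X(2)])
  also have "\<dots> \<le> (\<Sum>i\<le>card X * e. m ^ i)" using X(3) by (intro sum_mono power_mono) auto
  also have "\<dots> \<le> (\<Sum>i\<le>m * e. m ^ i)" using X(3) by (intro sum_mono2) auto
  finally show ?thesis using finite_subset[OF sub] fin by blast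
qed

end

section \<open>Assembling the explicit bound\<close>

context finite_gamma_values
begin

text \<open>The chain \<open>L\<close> is built from entries in the generating sets, but
  \<open>commutator_L\<close> absorbs arbitrary entries of \<open>N j\<close> one position at a
  time.\<close>

lemma gamma_N_mem_K:
  assumes "length xs = r" "\<And>i. i < r \<Longrightarrow> xs ! i \<in> N i"
  shows "gamma G xs \<in> K"
proof -
  have "gamma G (take (Suc j) xs) \<in> L (Suc j)" if "j < r" for j
    using that
  proof (induction j)
    case 0
    have ne: "xs \<noteq> []" using assms(1) r_pos by auto
    then have "gamma G (take 1 xs) = xs ! 0" by (cases xs) auto
    moreover have "take 1 Ss = [Ss ! 0]" using Ss_nonempty by (cases Ss) auto
    then have "word_values (gamma G) (take 1 Ss) = Ss ! 0" by (simp add: word_values_def image_image)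
    ultimately show ?case using assms(2)[OF 0] by (simp add: L_def N_def)
  next
    case (Suc j)
    have "take (Suc (Suc j)) xs = take (Suc j) xs @ [xs ! Suc j]"
      using Suc assms(1) by (simp add: take_Suc_conv_app_nth)
    moreover have "take (Suc j) xs \<noteq> []" using Suc.prems assms(1) by auto
    note gamma_append[OF this, of G "[xs ! Suc j]"]
    ultimately have "gamma G (take (Suc (Suc j)) xs) = commutator G (gamma G (take (Suc j) xs)) (xs ! Suc j)"
      by simp
    then show ?case using commutator_L[of "Suc j"] Suc assms(2) by simp
  qed
  from this[of "r - 1"] show ?thesis using r_pos assms(1) by (simp add: K_def)
qed

lemma K_finite_bounded:
  assumes pos: "\<And>i. i < r \<Longrightarrow> ns ! i \<ge> 1"
  defines "e \<equiv> e0 * (e0 ^ Suc r) ^ (r - 1) * fact (m ^ m) * fact (m ^ m)"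
  shows "finite K \<and> card K \<le> (\<Sum>i\<le>m * e. m ^ i)"
proof -
  let ?X = "word_values (gamma G) Ss"
  have X: "normal_subset ?X G" by (intro normal_subset_word_values normal_S)
  have XK: "?X \<subseteq> K" using gamma_mem_K by (auto simp: word_values_def)
  have subK: "subgroup K G" by (rule normal_imp_subgroup[OF normal_K])
  \<comment> \<open>The centre and transfer argument runs inside \<open>K\<close>, which the values
    generate; Dietzmann's lemma is applied afterwards in \<open>G\<close>.\<close>
  let ?H = "G\<lparr>carrier := K\<rparr>"
  interpret H: group ?H using subgroup_imp_group[OF subK] .
  \<comment> \<open>Dietzmann's lemma needs a positive exponent; this is where
    \<open>ns ! i \<ge> 1\<close> enters.\<close>
  have "0 \<notin> set ns" using pos length_ns by (fastforce simp: in_set_conv_nth r_def)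
  then have "prod_list ns \<noteq> 0" by (simp add: prod_list_zero_iff)
  then have "e0 > 0" by (simp add: e0_def)
  then have e: "e > 0" by (simp add: e_def)
  have "x [^] e = \<one>" if "x \<in> ?X" for x
  proof -
    have "x [^]\<^bsub>?H\<^esub> e = \<one>\<^bsub>?H\<^esub>"
      unfolding e_def
    proof (rule H.pow_eq_one_of_pow_mem_derived[OF _ finite_values card_values])
      show "normal_subset ?X ?H"
        unfolding normal_subset_def
      proof (intro conjI ballI)
        fix g s assume g: "g \<in> carrier ?H" and "s \<in> ?X"
        then show "inv\<^bsub>?H\<^esub> g \<otimes>\<^bsub>?H\<^esub> s \<otimes>\<^bsub>?H\<^esub> g \<in> ?X"
          using normal_subset_conj[OF X, of g s] K_carrier m_inv_consistent[OF subK, of g] by simp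
      qed (use XK in simp)
      show "generate ?H ?X = carrier ?H" using generate_consistent[OF XK subK] K_eq by simp
      show "x \<in> carrier ?H" using that XK by auto
      have "x [^] (e0 * (e0 ^ Suc r) ^ (r - 1)) \<in> derived G K"
        using K_pow_mem_derived that XK by blast
      then show "x [^]\<^bsub>?H\<^esub> (e0 * (e0 ^ Suc r) ^ (r - 1)) \<in> derived ?H (carrier ?H)"
        using derived_consistent[OF subset_refl subK] nat_pow_consistent[of x _ K] by simp
    qed
    then show ?thesis using nat_pow_consistent[of x e K] by simp
  qed
  then show ?thesis
    unfolding K_eq using dietzmann[OF X finite_values card_values e] by blast
qed

end

section \<open>Passage to countable groups\<close>

text \<open>The powers of \<open>e0\<close> carry \<open>K\<close> into its derived subgroup, the
  two factorials come from the index of the centre, and the sum counts words of length at most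
  \<open>m * e\<close> over \<open>m\<close> letters.\<close>

definition gamma_bound :: "nat \<Rightarrow> nat \<Rightarrow> nat list \<Rightarrow> nat"
  where "gamma_bound m r ns =
    (let e0 = prod_list ns * fact m;
         e = e0 * (e0 ^ Suc r) ^ (r - 1) * fact (m ^ m) * fact (m ^ m)
     in \<Sum>i\<le>m * e. m ^ i)"

lemma gamma_order_bounded_gamma_bound:
  fixes G (structure)
  assumes "group G"
  shows "gamma_order_bounded gamma_bound G"
  unfolding gamma_order_bounded_def
proof (intro allI impI)
  fix r m Ns Ss ns
  assume r: "1 \<le> r" and tup: "normally_generated_tuple G r Ns Ss ns"
    and fin: "finite (word_values (gamma G) Ss)" and card: "card (word_values (gamma G) Ss) = m"
  have len: "length Ns = r" "length Ss = r" "length ns = r"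
    and tup': "\<And>i. i < r \<Longrightarrow> Ns ! i = generate G (Ss ! i)"
      "\<And>i. i < r \<Longrightarrow> normal_subset (Ss ! i) G" "\<And>i. i < r \<Longrightarrow> ns ! i \<ge> 1"
      "\<And>i x. i < r \<Longrightarrow> x \<in> Ns ! i \<Longrightarrow> x [^]\<^bsub>G\<^esub> (ns ! i) \<in> Ss ! i"
    using tup by (auto simp: normally_generated_tuple_def)
  interpret group G by fact
  interpret V: finite_gamma_values G Ss ns m
  proof
    show "Ss \<noteq> []" using len r by auto
    show "normal_subset S G" if "S \<in> set Ss" for S
      using that tup'(2) len by (auto simp: in_set_conv_nth)
    show "x [^] (ns ! i) \<in> Ss ! i" if "i < length Ss" "x \<in> generate G (Ss ! i)" for i x
      using that tup'(1,4) len by simp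
  qed (use fin card len in auto)
  have rV: "V.r = r" using len by (simp add: V.r_def)
  have K: "finite V.K" "card V.K \<le> gamma_bound m r ns"
    using V.K_finite_bounded tup'(3) by (simp_all add: rV gamma_bound_def V.e0_def Let_def)
  have "word_values (gamma G) Ns \<subseteq> V.K"
  proof
    fix v assume "v \<in> word_values (gamma G) Ns"
    then obtain xs where xs: "v = gamma G xs" "xs \<in> listset Ns" by (auto simp: word_values_def)
    have "length xs = V.r" "\<And>i. i < V.r \<Longrightarrow> xs ! i \<in> V.N i"
      using xs(2) len tup'(1) by (auto simp: rV V.N_def mem_listset_iff list_all2_conv_all_nth)
    then show "v \<in> V.K" unfolding xs(1) by (rule V.gamma_N_mem_K)
  qed
  then have "word_subgroup G (gamma G) Ns \<subseteq> V.K"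
    unfolding word_subgroup_def
    by (intro generate_subgroup_incl normal_imp_subgroup V.normal_K)
  then show "finite (word_subgroup G (gamma G) Ns) \<and>
      card (word_subgroup G (gamma G) Ns) \<le> gamma_bound m r ns"
    using K finite_subset card_mono le_trans by meson
qed

section \<open>Finitely generated subgroups and embeddings of countable groups\<close>

context group
begin

lemma generate_finitary:
  assumes "x \<in> generate G A"
  shows "\<exists>B. finite B \<and> B \<subseteq> A \<and> x \<in> generate G B"
  using assms
proof (induction x rule: generate.induct)
  case one
  show ?case by (intro exI[of _ "{}"]) (auto intro: generate.one)
next
  case (incl h)
  then show ?case by (intro exI[of _ "{h}"]) (auto intro: generate.incl)
next
  case (inv h)
  then show ?case by (intro exI[of _ "{h}"]) (auto intro: generate.inv)
next
  case (eng h1 h2)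
  then obtain B C where "finite B" "B \<subseteq> A" "h1 \<in> generate G B" "finite C" "C \<subseteq> A" "h2 \<in> generate G C"
    by blast
  then show ?case
    using mono_generate[of B "B \<union> C"] mono_generate[of C "B \<union> C"]
    by (intro exI[of _ "B \<union> C"]) (auto intro: generate.eng)
qed

lemma finite_subset_generate_finitary:
  assumes "finite F" "F \<subseteq> generate G A"
  shows "\<exists>B. finite B \<and> B \<subseteq> A \<and> F \<subseteq> generate G B"
  using assms
proof (induction F)
  case (insert x F)
  then obtain B C where "finite B" "B \<subseteq> A" "F \<subseteq> generate G B" "finite C" "C \<subseteq> A" "x \<in> generate G C"
    using generate_finitary[of x A] by auto
  then show ?case
    using mono_generate[of B "B \<union> C"] mono_generate[of C "B \<union> C"]
    by (intro exI[of _ "B \<union> C"]) auto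
qed auto

lemma countable_generate:
  assumes "countable Y" "Y \<subseteq> carrier G"
  shows "countable (generate G Y)"
proof -
  let ?W = "lists (Y \<union> m_inv G ` Y)"
  have W: "set ws \<subseteq> carrier G" if "ws \<in> ?W" for ws using that assms(2) by (fastforce simp: in_lists_conv_set)
  have "g \<in> word_product ` ?W" if "g \<in> generate G Y" for g
    using that
  proof (induction g rule: generate.induct)
    case one
    show ?case by (rule image_eqI[of _ _ "[]"]) auto
  next
    case (incl h)
    then show ?case using assms(2) by (intro image_eqI[of _ _ "[h]"]) auto
  next
    case (inv h)
    then show ?case using assms(2) by (intro image_eqI[of _ _ "[inv h]"]) auto
  next
    case (eng h1 h2)
    then obtain us vs where "us \<in> ?W" "word_product us = h1" "vs \<in> ?W" "word_product vs = h2"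
      by blast
    then show ?case
      using word_product_append[of us vs] W by (intro image_eqI[of _ _ "us @ vs"]) auto
  qed
  moreover have "countable (word_product ` ?W)" using assms(1) by auto
  ultimately show ?thesis by (meson countable_subset subsetI)
qed

text \<open>The subgroup generated by \<open>Y\<close> is countable, so its multiplication can be
  transported along an injection into the natural numbers; \<open>\<phi>\<close> is the inverse of
  this injection.\<close>

lemma countable_embedding:
  assumes "countable Y" "Y \<subseteq> carrier G"
  shows "\<exists>(H :: nat monoid) \<phi>. group H \<and> \<phi> \<in> hom H G \<and> inj_on \<phi> (carrier H) \<and> Y \<subseteq> \<phi> ` carrier H"
proof -
  let ?K = "generate G Y"
  interpret K: subgroup ?K G by (rule generate_is_subgroup[OF assms(2)])
  define h where "h = to_nat_on ?K"
  define \<phi> where "\<phi> = inv_into ?K h"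
  have inj: "inj_on h ?K" unfolding h_def using countable_generate[OF assms] by (rule inj_on_to_nat_on)
  have \<phi>h: "\<phi> (h x) = x" if "x \<in> ?K" for x unfolding \<phi>_def using inj that by simp
  define H :: "nat monoid"
    where "H = \<lparr>carrier = h ` ?K, monoid.mult = (\<lambda>a b. h (\<phi> a \<otimes> \<phi> b)), one = h \<one>\<rparr>"
  have "group H"
  proof (rule groupI)
    show "\<exists>y\<in>carrier H. y \<otimes>\<^bsub>H\<^esub> x = \<one>\<^bsub>H\<^esub>" if x: "x \<in> carrier H" for x
    proof -
      obtain k where "k \<in> ?K" "x = h k" using x by (auto simp: H_def)
      then show ?thesis
        by (intro bexI[of _ "h (inv k)"]) (auto simp: H_def \<phi>h K.mem_carrier)
    qed
  qed (auto simp: H_def \<phi>h K.mem_carrier m_assoc)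
  moreover have "\<phi> \<in> hom H G" by (auto simp: hom_def H_def \<phi>h K.mem_carrier)
  moreover have "inj_on \<phi> (carrier H)" by (auto simp: inj_on_def H_def \<phi>h)
  moreover have "Y \<subseteq> \<phi> ` carrier H"
    by (auto simp: H_def image_image \<phi>h intro: generate.incl)
  ultimately show ?thesis by blast
qed

end

section \<open>Pulling tuples back along an injective homomorphism\<close>

lemma (in group_hom) hom_gamma:
  assumes "set xs \<subseteq> carrier G"
  shows "h (gamma G xs) = gamma H (map h xs)"
proof (cases xs)
  case (Cons x zs)
  have "h (foldl (commutator G) x zs) = foldl (commutator H) (h x) (map h zs)"
    if "x \<in> carrier G" "set zs \<subseteq> carrier G" for x zs
    using that by (induction zs arbitrary: x) (auto simp: hom_commutator)
  then show ?thesis using Cons assms by simp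
qed simp

text \<open>The pulled back tuple need not have the same \<open>\<gamma>\<^sub>r(N)\<close>, but by the last assumption it still
  sees all of \<open>F\<close>.\<close>

lemma (in group_hom) pullback_tuple:
  assumes inj: "inj_on h (carrier G)"
    and tup: "normally_generated_tuple H r Ns Ss ns"
    and hit: "\<And>v. v \<in> word_values (gamma H) Ss \<Longrightarrow>
      \<exists>xs \<in> listset Ss. v = gamma H xs \<and> set xs \<subseteq> h ` carrier G"
    and F: "F \<subseteq> generate H {gamma H xs |xs. length xs = r \<and>
      (\<forall>i<r. xs ! i \<in> generate H (Ss ! i \<inter> h ` carrier G))}"
  obtains Ns' Ss' where "normally_generated_tuple G r Ns' Ss' ns"
    and "h ` word_values (gamma G) Ss' = word_values (gamma H) Ss"
    and "word_values (gamma G) Ss' \<subseteq> carrier G"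
    and "F \<subseteq> h ` word_subgroup G (gamma G) Ns'"
proof -
  define Ss' where "Ss' = map (\<lambda>S. {x \<in> carrier G. h x \<in> S}) Ss"
  define Ns' where "Ns' = map (generate G) Ss'"
  have len: "length Ns = r" "length Ss = r" "length ns = r"
    and tup': "\<And>i. i < r \<Longrightarrow> Ns ! i = generate H (Ss ! i)"
      "\<And>i. i < r \<Longrightarrow> normal_subset (Ss ! i) H" "\<And>i. i < r \<Longrightarrow> ns ! i \<ge> 1"
      "\<And>i x. i < r \<Longrightarrow> x \<in> Ns ! i \<Longrightarrow> x [^]\<^bsub>H\<^esub> (ns ! i) \<in> Ss ! i"
    using tup by (auto simp: normally_generated_tuple_def)
  have len': "length Ss' = r" "length Ns' = r" by (simp_all add: Ss'_def Ns'_def len)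
  have S': "Ss' ! i = {x \<in> carrier G. h x \<in> Ss ! i}" if "i < r" for i
    using that len by (simp add: Ss'_def)
  have N': "Ns' ! i = generate G (Ss' ! i)" if "i < r" for i
    using that len len' by (simp add: Ns'_def)
  have S'c: "Ss' ! i \<subseteq> carrier G" if "i < r" for i using S' that by auto
  have img: "h ` (Ss' ! i) = Ss ! i \<inter> h ` carrier G" if "i < r" for i using S' that by auto
  have gen_img: "h ` (Ns' ! i) = generate H (Ss ! i \<inter> h ` carrier G)" if "i < r" for i
    using generate_img[OF S'c[OF that]] img[OF that] N'[OF that] by simp
  have normal_S': "normal_subset (Ss' ! i) G" if "i < r" for i
    using H.normal_subset_conj[OF tup'(2)[OF that]] that by (auto simp: normal_subset_def S')
  have tuple': "normally_generated_tuple G r Ns' Ss' ns"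
    unfolding normally_generated_tuple_def
  proof (intro conjI allI impI ballI)
    fix i assume i: "i < r"
    show "Ns' ! i \<lhd> G" unfolding N'[OF i] by (rule G.normal_generate[OF normal_S'[OF i]])
    fix x assume x: "x \<in> Ns' ! i"
    then have xc: "x \<in> carrier G"
      using G.generate_in_carrier[OF S'c[OF i]] N'[OF i] by blast
    \<comment> \<open>The image of \<open>Ns' ! i\<close> is generated by a part of
      \<open>Ss ! i\<close>, hence lies in \<open>Ns ! i\<close>, and the power condition pulls
      back.\<close>
    have "h x \<in> Ns ! i"
      using x gen_img[OF i] H.mono_generate[of "Ss ! i \<inter> h ` carrier G" "Ss ! i"] tup'(1)[OF i] by blast
    then have "h (x [^] (ns ! i)) \<in> Ss ! i" using tup'(4)[OF i] hom_nat_pow[OF xc] by simp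
    then show "x [^] (ns ! i) \<in> Ss' ! i" using xc by (simp add: S'[OF i])
  qed (use len len' N' normal_S' tup'(3) in auto)
  have listset'_carrier: "set xs \<subseteq> carrier G" if "xs \<in> listset Ss'" for xs
    using that S'c len' by (intro G.mem_listset_carrier[OF that]) (auto simp: in_set_conv_nth)
  \<comment> \<open>No value is lost, because \<open>hit\<close> attains each one on entries from
    the image of \<open>h\<close>.\<close>
  have vals: "h ` word_values (gamma G) Ss' = word_values (gamma H) Ss"
  proof (intro equalityI subsetI)
    fix v assume "v \<in> h ` word_values (gamma G) Ss'"
    then obtain xs where xs: "xs \<in> listset Ss'" "v = h (gamma G xs)" by (auto simp: word_values_def)
    have "map h xs \<in> listset Ss"
      using xs(1) len len' S' by (auto simp: mem_listset_iff list_all2_conv_all_nth)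
    then show "v \<in> word_values (gamma H) Ss"
      using hom_gamma[OF listset'_carrier[OF xs(1)]] xs(2) by (auto simp: word_values_def)
  next
    fix v assume "v \<in> word_values (gamma H) Ss"
    then obtain xs where xs: "xs \<in> listset Ss" "v = gamma H xs" "set xs \<subseteq> h ` carrier G"
      using hit by blast
    let ?xs = "map (inv_into (carrier G) h) xs"
    have id: "map h ?xs = xs" using xs(3) by (auto simp: f_inv_into_f subset_iff intro!: map_idI)
    have mem: "?xs \<in> listset Ss'"
      unfolding mem_listset_iff list_all2_conv_all_nth
    proof (intro conjI allI impI)
      show "length ?xs = length Ss'" using xs(1) len len' by (simp add: mem_listset_iff list_all2_conv_all_nth)
      fix i assume i: "i < length ?xs"
      then have "xs ! i \<in> h ` carrier G" "xs ! i \<in> Ss ! i" "i < r"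
        using xs(1,3) len by (auto simp: mem_listset_iff list_all2_conv_all_nth)
      then show "?xs ! i \<in> Ss' ! i" using i S' by (simp add: f_inv_into_f inv_into_into)
    qed
    have "v = h (gamma G ?xs)" using hom_gamma[OF listset'_carrier[OF mem]] id xs(2) by simp
    then show "v \<in> h ` word_values (gamma G) Ss'"
      using mem unfolding word_values_def by blast
  qed
  have vals_c: "word_values (gamma G) Ss' \<subseteq> carrier G"
    using listset'_carrier G.gamma_closed by (auto simp: word_values_def)
  have N'c: "Ns' ! i \<subseteq> carrier G" if "i < r" for i
    using G.generate_incl[OF S'c[OF that]] N'[OF that] by simp
  have listsetN'_carrier: "set xs \<subseteq> carrier G" if "xs \<in> listset Ns'" for xs
    using that N'c len' by (intro G.mem_listset_carrier[OF that]) (auto simp: in_set_conv_nth)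
  have "{gamma H xs |xs. length xs = r \<and> (\<forall>i<r. xs ! i \<in> generate H (Ss ! i \<inter> h ` carrier G))}
      \<subseteq> h ` word_values (gamma G) Ns'"
  proof clarify
    fix xs assume xs: "r = length xs" "\<forall>i<length xs. xs ! i \<in> generate H (Ss ! i \<inter> h ` carrier G)"
    have "\<forall>i<r. \<exists>y. y \<in> Ns' ! i \<and> xs ! i = h y" using xs gen_img by fastforce
    then obtain y where y: "\<And>i. i < r \<Longrightarrow> y i \<in> Ns' ! i \<and> xs ! i = h (y i)" by metis
    let ?ys = "map y [0..<r]"
    have ys: "?ys \<in> listset Ns'" using y len' by (simp add: mem_listset_iff list_all2_conv_all_nth)
    have "map h ?ys = xs" using y xs(1) by (auto intro!: nth_equalityI)
    then have "gamma H xs = h (gamma G ?ys)" using hom_gamma[OF listsetN'_carrier[OF ys]] by simp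
    then show "gamma H xs \<in> h ` word_values (gamma G) Ns'"
      using ys unfolding word_values_def by blast
  qed
  then have "F \<subseteq> generate H (h ` word_values (gamma G) Ns')"
    using F H.mono_generate by (meson subset_trans)
  moreover have "word_values (gamma G) Ns' \<subseteq> carrier G"
    using listsetN'_carrier G.gamma_closed by (auto simp: word_values_def)
  ultimately have "F \<subseteq> h ` word_subgroup G (gamma G) Ns'"
    by (simp add: generate_img word_subgroup_def)
  then show thesis using that tuple' vals vals_c by blast
qed

text \<open>\<open>Y\<close> collects the entries of one tuple for each of the finitely many values,
  and the finitely many generators used to express \<open>F\<close>. Entries from
  \<open>Ns ! i\<close> must be generated by \<open>Ss ! i \<inter> Y\<close>, not merely by
  \<open>Y\<close>, since the pulled back subgroups are generated by the pulled back sets.\<close>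

lemma (in group) finite_witness_set:
  assumes tup: "normally_generated_tuple G r Ns Ss ns"
    and fin: "finite (word_values (gamma G) Ss)"
    and F: "finite F" "F \<subseteq> word_subgroup G (gamma G) Ns"
  shows "\<exists>Y. finite Y \<and> Y \<subseteq> carrier G \<and>
    (\<forall>v \<in> word_values (gamma G) Ss. \<exists>xs \<in> listset Ss. v = gamma G xs \<and> set xs \<subseteq> Y) \<and>
    F \<subseteq> generate G {gamma G xs |xs. length xs = r \<and> (\<forall>i<r. xs ! i \<in> generate G (Ss ! i \<inter> Y))}"
proof -
  have len: "length Ns = r" "length Ss = r"
    and N: "\<And>i. i < r \<Longrightarrow> Ns ! i = generate G (Ss ! i)"
    and S: "\<And>i. i < r \<Longrightarrow> Ss ! i \<subseteq> carrier G"
    using tup normal_subset_carrier by (auto simp: normally_generated_tuple_def)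
  have "\<forall>v \<in> word_values (gamma G) Ss. \<exists>xs. xs \<in> listset Ss \<and> v = gamma G xs"
    by (auto simp: word_values_def)
  then obtain w where w: "\<And>v. v \<in> word_values (gamma G) Ss \<Longrightarrow> w v \<in> listset Ss \<and> v = gamma G (w v)"
    by metis
  define Y1 where "Y1 = (\<Union>v \<in> word_values (gamma G) Ss. set (w v))"
  have Y1: "finite Y1" "Y1 \<subseteq> carrier G"
  proof -
    show "finite Y1" using fin by (simp add: Y1_def)
    have "set (w v) \<subseteq> carrier G" if "v \<in> word_values (gamma G) Ss" for v
      using w[OF that] S len by (intro mem_listset_carrier[of "w v" Ss]) (auto simp: in_set_conv_nth)
    then show "Y1 \<subseteq> carrier G" by (auto simp: Y1_def)
  qed
  obtain B where B: "finite B" "B \<subseteq> word_values (gamma G) Ns" "F \<subseteq> generate G B"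
    using finite_subset_generate_finitary[OF F(1) F(2)[unfolded word_subgroup_def]] by blast
  have "\<exists>xs Z. length xs = r \<and> b = gamma G xs \<and> finite Z \<and> Z \<subseteq> carrier G \<and>
      (\<forall>i<r. xs ! i \<in> generate G (Ss ! i \<inter> Z))" if b: "b \<in> B" for b
  proof -
    obtain xs where xs: "xs \<in> listset Ns" "b = gamma G xs" using b B(2) by (auto simp: word_values_def)
    have xs': "length xs = r" "\<And>i. i < r \<Longrightarrow> xs ! i \<in> generate G (Ss ! i)"
      using xs(1) N len by (auto simp: mem_listset_iff list_all2_conv_all_nth)
    have "\<forall>i. \<exists>C. i < r \<longrightarrow> finite C \<and> C \<subseteq> Ss ! i \<and> xs ! i \<in> generate G C"
      using generate_finitary xs'(2) by meson
    then obtain C where C: "\<And>i. i < r \<Longrightarrow> finite (C i) \<and> C i \<subseteq> Ss ! i \<and> xs ! i \<in> generate G (C i)"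
      by metis
    let ?Z = "\<Union>i<r. C i"
    have "xs ! i \<in> generate G (Ss ! i \<inter> ?Z)" if "i < r" for i
      using C[OF that] mono_generate[of "C i" "Ss ! i \<inter> ?Z"] that by blast
    moreover have "finite ?Z" using C by simp
    moreover have "?Z \<subseteq> carrier G" using C S by blast
    ultimately show ?thesis using xs' xs(2) by blast
  qed
  then obtain x Z where xZ: "\<And>b. b \<in> B \<Longrightarrow> length (x b) = r \<and> b = gamma G (x b) \<and> finite (Z b) \<and>
      Z b \<subseteq> carrier G \<and> (\<forall>i<r. x b ! i \<in> generate G (Ss ! i \<inter> Z b))"
    by metis
  define Y where "Y = Y1 \<union> (\<Union>b\<in>B. Z b)"
  have "finite Y" "Y \<subseteq> carrier G" using Y1 B(1) xZ by (auto simp: Y_def)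
  moreover have "\<exists>xs \<in> listset Ss. v = gamma G xs \<and> set xs \<subseteq> Y" if "v \<in> word_values (gamma G) Ss" for v
    using w[OF that] that by (intro bexI[of _ "w v"]) (auto simp: Y_def Y1_def)
  moreover have "B \<subseteq> {gamma G xs |xs. length xs = r \<and> (\<forall>i<r. xs ! i \<in> generate G (Ss ! i \<inter> Y))}"
  proof
    fix b assume b: "b \<in> B"
    have "x b ! i \<in> generate G (Ss ! i \<inter> Y)" if "i < r" for i
      using xZ[OF b] that b mono_generate[of "Ss ! i \<inter> Z b" "Ss ! i \<inter> Y"] unfolding Y_def by blast
    then show "b \<in> {gamma G xs |xs. length xs = r \<and> (\<forall>i<r. xs ! i \<in> generate G (Ss ! i \<inter> Y))}"
      using xZ[OF b] by blast
  qed
  then have "F \<subseteq> generate G {gamma G xs |xs. length xs = r \<and> (\<forall>i<r. xs ! i \<in> generate G (Ss ! i \<inter> Y))}"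
    using B(3) mono_generate by blast
  ultimately show ?thesis by blast
qed

text \<open>Every finite part of the subgroup is visible in a group on natural numbers with the same
  parameters, so it has at most \<open>f m r ns\<close> elements. A uniform bound on finite subsets
  gives both finiteness and the order bound.\<close>

lemma gamma_order_bounded_of_nat:
  fixes G :: "('a, 'b) monoid_scheme"
  assumes f: "\<And>H :: nat monoid. group H \<Longrightarrow> gamma_order_bounded f H" and G: "group G"
  shows "gamma_order_bounded f G"
  unfolding gamma_order_bounded_def
proof (intro allI impI)
  fix r m Ns Ss ns
  assume r: "1 \<le> r" and tup: "normally_generated_tuple G r Ns Ss ns"
    and fin: "finite (word_values (gamma G) Ss)" and card: "card (word_values (gamma G) Ss) = m"
  interpret group G by fact
  have "card F \<le> f m r ns" if F: "F \<subseteq> word_subgroup G (gamma G) Ns" "finite F" for F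
  proof -
    obtain Y where Y: "finite Y" "Y \<subseteq> carrier G"
      and vals: "\<And>v. v \<in> word_values (gamma G) Ss \<Longrightarrow> \<exists>xs \<in> listset Ss. v = gamma G xs \<and> set xs \<subseteq> Y"
      and FY: "F \<subseteq> generate G {gamma G xs |xs. length xs = r \<and> (\<forall>i<r. xs ! i \<in> generate G (Ss ! i \<inter> Y))}"
      using finite_witness_set[OF tup fin F(2,1)] by blast
    obtain H :: "nat monoid" and \<phi> where H: "group H" "\<phi> \<in> hom H G" "inj_on \<phi> (carrier H)"
      and YH: "Y \<subseteq> \<phi> ` carrier H"
      using countable_embedding[OF countable_finite[OF Y(1)] Y(2)] by blast
    interpret H: group_hom H G \<phi>
      using H(1,2) G by (simp add: group_hom_def group_hom_axioms_def)
    have "\<exists>xs \<in> listset Ss. v = gamma G xs \<and> set xs \<subseteq> \<phi> ` carrier H"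
      if "v \<in> word_values (gamma G) Ss" for v
      using vals[OF that] YH by blast
    moreover have "F \<subseteq> generate G {gamma G xs |xs. length xs = r \<and>
        (\<forall>i<r. xs ! i \<in> generate G (Ss ! i \<inter> \<phi> ` carrier H))}"
    proof -
      have "generate G (Ss ! i \<inter> Y) \<subseteq> generate G (Ss ! i \<inter> \<phi> ` carrier H)" for i
        using YH by (intro mono_generate) blast
      then show ?thesis using FY by (elim subset_trans) (intro mono_generate, blast)
    qed
    ultimately obtain Ns' Ss' where tup': "normally_generated_tuple H r Ns' Ss' ns"
      and vals': "\<phi> ` word_values (gamma H) Ss' = word_values (gamma G) Ss"
      and valsc: "word_values (gamma H) Ss' \<subseteq> carrier H"
      and F': "F \<subseteq> \<phi> ` word_subgroup H (gamma H) Ns'"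
      using H.pullback_tuple[OF H(3) tup] by blast
    \<comment> \<open>Injectivity keeps the number of values equal to \<open>m\<close>, so
      \<open>f\<close> is evaluated at the same arguments.\<close>
    have inj: "inj_on \<phi> (word_values (gamma H) Ss')" by (rule inj_on_subset[OF H(3) valsc])
    have "finite (word_values (gamma H) Ss')" using fin vals' inj finite_image_iff by metis
    moreover have "card (word_values (gamma H) Ss') = m" using card vals' card_image[OF inj] by simp
    ultimately have "finite (word_subgroup H (gamma H) Ns')" "card (word_subgroup H (gamma H) Ns') \<le> f m r ns"
      using f[OF H(1)] r tup' unfolding gamma_order_bounded_def by blast+
    then show ?thesis using surj_card_le[OF _ F'] le_trans by blast
  qed
  then show "finite (word_subgroup G (gamma G) Ns) \<and> card (word_subgroup G (gamma G) Ns) \<le> f m r ns"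
    by (intro finite_if_finite_subsets_card_bdd) blast
qed

theorem theorem2p11:
  shows "(\<exists>f. \<forall>G :: nat monoid. group G \<longrightarrow> gamma_order_bounded f G) \<and>
    (\<forall>f. (\<forall>G :: nat monoid. group G \<longrightarrow> gamma_order_bounded f G) \<longrightarrow>
         (\<forall>G :: ('a, 'b) monoid_scheme. group G \<longrightarrow> gamma_order_bounded f G))"
  using gamma_order_bounded_gamma_bound gamma_order_bounded_of_nat by blast

end
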